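(* Let $n\ge 1$, let $p$ be a prime, let $G=T_{4n}\le S_{4n}$, let $V$ be a nonzero finite-dimensional complex inner product space, let $\epsilon=4$ if $p\ne2$ and $\epsilon=1$ if $p=2$, let $0\le h<\epsilon$, and let $\phi=\hat\chi_h$ (if $n$ is even) or $\phi=\hat\chi'_h$ (if $n$ is odd). Then the space $V_\phi(G)$ has an o-basis if and only if at least one of the following holds: (i) $\dim V=1$; (ii) $p=2$; (iii) $2n$ is not divisible by $p$.
   Context: The dicyclic group is $T_{4n}=\langle r,s\mid r^{2n}=e,\ r^n=s^2,\ s^{-1}rs=r^{-1}\rangle=\{r^i,sr^i:0\le i<2n\}$. It is embedded in $S_{4n}$ (Cayley) by $r=(1\,2\cdots 2n)(2n+1\ \ 2n+2\cdots 4n)$ and $s=(1\ \ 2n+1\ \ n+1\ \ 3n+1)\prod_{i=2}^{n}(i\ \ 4n+2-i\ \ n+i\ \ 3n+2-i)$. Linear characters of $T_{4n}$: for $n$ even, $\chi_0,\chi_1,\chi_2,\chi_3$ are given by $(\chi(r),\chi(s))=(1,1),(-1,1),(1,-1),(-1,-1)$ respectively; for $n$ odd, $\chi'_0,\chi'_1,\chi'_2,\chi'_3$ are given by $(\chi'(r),\chi'(s))=(1,1),(-1,i),(1,-1),(-1,-i)$ respectively. $\hat G$ is the set of $p$-regular elements of $G$ (order not divisible by $p$), and $\hat\chi_h=\chi_h|_{\hat G}$, $\hat\chi'_h=\chi'_h|_{\hat G}$. Symmetry classes: for $G\le S_m$ (here $m=4n$), let $\{e_1,\dots,e_k\}$ be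 an orthonormal basis of $V$, $k=\dim V$; $\Gamma^m_k$ is the set of sequences $\alpha=(\alpha_1,\dots,\alpha_m)$ with $1\le\alpha_i\le k$; $\alpha\sigma=(\alpha_{\sigma(1)},\dots,\alpha_{\sigma(m)})$ for $\sigma\in G$; $e_\alpha=e_{\alpha_1}\otimes\cdots\otimes e_{\alpha_m}$; $V^{\otimes m}$ has the induced inner product, for which the $e_\alpha$ are orthonormal. For $\phi:S\to\mathbb{C}$ (here $S=\hat G$), $$e^\phi_\alpha=\frac{\phi(e)}{|S|}\sum_{\sigma\in S}\phi(\sigma)e_{\alpha\sigma^{-1}},\qquad V_\phi(G)=\operatorname{span}\{e^\phi_\alpha:\alpha\in\Gamma^m_k\}.$$ An o-basis of a subspace $W\subseteq V_\phi(G)$ is an orthogonal basis of $W$ of the form $\{e^\phi_{\alpha_1},\dots,e^\phi_{\alpha_t}\}$ with $\alpha_i\in\Gamma^m_k$; the empty set is an o-basis of the zero subspace. *)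

theory Defs
  imports
    Complex_Main
    "HOL-Algebra.Sym_Groups"
    "HOL-Algebra.Multiplicative_Group"
    "HOL-Computational_Algebra.Primes"
    "HOL-Library.FuncSet"
    "HOL-Library.Function_Algebras"
begin

section \<open>The dicyclic group inside the symmetric group\<close>

text \<open>Permutations of \<open>{1..m}\<close> are functions on \<open>nat\<close> that fix everything outside \<open>{1..m}\<close>, and the
  product is composition, as in \<^const>\<open>sym_group\<close>.  \<open>cycle_of_list [a, b, c]\<close> maps \<open>a\<close> to \<open>b\<close>,
  \<open>b\<close> to \<open>c\<close> and \<open>c\<close> to \<open>a\<close>.\<close>

definition dic_r :: "nat \<Rightarrow> nat \<Rightarrow> nat" where
  "dic_r n = cycle_of_list [1..<2*n+1] \<circ> cycle_of_list [2*n+1..<4*n+1]"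

definition dic_s :: "nat \<Rightarrow> nat \<Rightarrow> nat" where
  "dic_s n = cycle_of_list [1, 2*n+1, n+1, 3*n+1] \<circ>
     foldr (\<circ>) (map (\<lambda>i. cycle_of_list [i, 4*n+2-i, n+i, 3*n+2-i]) [2..<n+1]) id"

definition dicyclic :: "nat \<Rightarrow> (nat \<Rightarrow> nat) monoid" where
  "dicyclic n = (sym_group (4*n)) \<lparr> carrier := generate (sym_group (4*n)) {dic_r n, dic_s n} \<rparr>"

lemma dic_r_permutes: "dic_r n permutes {1..4*n}"
  unfolding dic_r_def
  by (intro permutes_compose permutes_subset[OF cycle_permutes]) auto

lemma dic_s_permutes: "n \<ge> 1 \<Longrightarrow> dic_s n permutes {1..4*n}"
proof -
  assume n: "n \<ge> 1"
  have fold: "foldr (\<circ>) (map c xs) id permutes A" if "\<And>i. i \<in> set xs \<Longrightarrow> c i permutes A"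
    for c :: "nat \<Rightarrow> nat \<Rightarrow> nat" and xs A
    using that
  proof (induction xs)
    case (Cons x xs)
    have "foldr (\<circ>) (map c xs) id permutes A"
      by (rule Cons.IH) (rule Cons.prems, simp)
    moreover have "c x permutes A"
      by (rule Cons.prems) simp
    ultimately have "c x \<circ> foldr (\<circ>) (map c xs) id permutes A"
      by (rule permutes_compose)
    moreover have "foldr (\<circ>) (map c (x # xs)) id = c x \<circ> foldr (\<circ>) (map c xs) id"
      by (simp add: fun_eq_iff)
    ultimately show ?case
      by (simp only:)
  qed (simp add: permutes_id)
  have "foldr (\<circ>) (map (\<lambda>i. cycle_of_list [i, 4*n+2-i, n+i, 3*n+2-i]) [2..<n+1]) id
      permutes {1..4*n}"
    by (rule fold, rule permutes_subset[OF cycle_permutes]) auto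
  moreover have "cycle_of_list [1, 2*n+1, n+1, 3*n+1] permutes {1..4*n}"
    by (rule permutes_subset[OF cycle_permutes]) (use n in auto)
  ultimately show ?thesis
    unfolding dic_s_def by (rule permutes_compose)
qed

lemma dicyclic_group: "n \<ge> 1 \<Longrightarrow> group (dicyclic n)"
  unfolding dicyclic_def
  by (intro subgroup.subgroup_is_group group.generate_is_subgroup sym_group_is_group)
    (use dic_r_permutes dic_s_permutes in \<open>auto simp: sym_group_carrier\<close>)

definition p_regular :: "('a, 'b) monoid_scheme \<Rightarrow> nat \<Rightarrow> 'a set" where
  "p_regular G p = {\<sigma> \<in> carrier G. \<not> p dvd group.ord G \<sigma>}"

definition complex_units :: "complex monoid" where
  "complex_units = \<lparr> carrier = UNIV - {0}, mult = (*), one = 1 \<rparr>"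

definition dic_char_values :: "nat \<Rightarrow> nat \<Rightarrow> complex \<times> complex" where
  "dic_char_values n h =
     (if even n then [(1, 1), (-1, 1), (1, -1), (-1, -1)] ! h
      else [(1, 1), (-1, \<i>), (1, -1), (-1, -\<i>)] ! h)"

text \<open>For \<open>h < 4\<close>: \<open>\<chi>\<close> is (on the group) the linear character \<open>\<chi>\<^sub>h\<close> if \<open>n\<close> is even,
  and \<open>\<chi>'\<^sub>h\<close> if \<open>n\<close> is odd; being a homomorphism, it is determined by its values on the generators.\<close>

definition is_dic_char :: "nat \<Rightarrow> nat \<Rightarrow> ((nat \<Rightarrow> nat) \<Rightarrow> complex) \<Rightarrow> bool" where
  "is_dic_char n h \<chi> \<longleftrightarrow>
     \<chi> \<in> hom (dicyclic n) complex_units \<and>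
     (\<chi> (dic_r n), \<chi> (dic_s n)) = dic_char_values n h"


section \<open>Complex inner product spaces and their tensor powers\<close>

locale complex_inner_product_space = vector_space scale
  for scale :: "complex \<Rightarrow> 'v::ab_group_add \<Rightarrow> 'v" +
  fixes ip :: "'v \<Rightarrow> 'v \<Rightarrow> complex"
  assumes ip_add_left: "ip (x + y) z = ip x z + ip y z"
    and ip_scale_left: "ip (scale c x) z = c * ip x z"
    and ip_cnj: "ip y x = cnj (ip x y)"
    and ip_pos: "x \<noteq> 0 \<Longrightarrow> 0 < Re (ip x x)"
begin

definition finite_dimensional :: bool where
  "finite_dimensional \<longleftrightarrow> (\<exists>B. finite B \<and> span B = UNIV)"

text \<open>Orthonormal basis \<open>e 1, \<dots>, e k\<close> with \<open>k\<close> the dimension of the space;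
  the values of \<open>e\<close> at other indices are irrelevant.\<close>

definition orthonormal_basis :: "(nat \<Rightarrow> 'v) \<Rightarrow> bool" where
  "orthonormal_basis e \<longleftrightarrow>
     (\<forall>i\<in>{1..dim UNIV}. \<forall>j\<in>{1..dim UNIV}. ip (e i) (e j) = (if i = j then 1 else 0)) \<and>
     span (e ` {1..dim UNIV}) = UNIV"

text \<open>The tensor power \<open>V\<^sup>\<otimes>\<^sup>m\<close> is realised by conjugate-multilinear forms on \<open>V\<^sup>m\<close>: the
  decomposable tensor \<open>x\<^sub>1 \<otimes> \<dots> \<otimes> x\<^sub>m\<close> is the form sending \<open>(y\<^sub>1, \<dots>, y\<^sub>m)\<close> to
  \<open>\<langle>x\<^sub>1, y\<^sub>1\<rangle> \<cdots> \<langle>x\<^sub>m, y\<^sub>m\<rangle>\<close>.  An \<open>m\<close>-tuple is a function on \<open>nat\<close> of which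
  only the values on \<open>{1..m}\<close> matter.\<close>

definition tensor :: "nat \<Rightarrow> (nat \<Rightarrow> 'v) \<Rightarrow> (nat \<Rightarrow> 'v) \<Rightarrow> complex" where
  "tensor m x = (\<lambda>y. \<Prod>i=1..m. ip (x i) (y i))"

definition Gamma :: "nat \<Rightarrow> (nat \<Rightarrow> nat) set" where
  "Gamma m = {1..m} \<rightarrow>\<^sub>E {1..dim UNIV}"

definition basis_tensor :: "nat \<Rightarrow> (nat \<Rightarrow> 'v) \<Rightarrow> (nat \<Rightarrow> nat) \<Rightarrow> (nat \<Rightarrow> 'v) \<Rightarrow> complex" where
  "basis_tensor m e \<alpha> = tensor m (\<lambda>i. e (\<alpha> i))"

text \<open>The induced inner product on \<open>V\<^sup>\<otimes>\<^sup>m\<close>: since \<open>\<langle>F, e\<^sub>\<alpha>\<rangle> = F (e\<^bsub>\<alpha>\<^sub>1\<^esub>, \<dots>, e\<^bsub>\<alpha>\<^sub>m\<^esub>)\<close>,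
  it is the standard inner product of the coordinates with respect to the orthonormal basis of the
  \<open>e\<^sub>\<alpha>\<close>.  By lemma \<open>tensor_ip_tensor\<close> below it does not depend on \<open>e\<close>.\<close>

definition tensor_ip ::
    "nat \<Rightarrow> (nat \<Rightarrow> 'v) \<Rightarrow> ((nat \<Rightarrow> 'v) \<Rightarrow> complex) \<Rightarrow> ((nat \<Rightarrow> 'v) \<Rightarrow> complex) \<Rightarrow> complex" where
  "tensor_ip m e F H = (\<Sum>\<alpha>\<in>Gamma m. F (\<lambda>i. e (\<alpha> i)) * cnj (H (\<lambda>i. e (\<alpha> i))))"

end

definition tensor_scale :: "complex \<Rightarrow> ('a \<Rightarrow> complex) \<Rightarrow> 'a \<Rightarrow> complex" where
  "tensor_scale c F = (\<lambda>y. c * F y)"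

global_interpretation tensor_space: vector_space tensor_scale
  defines tensor_span = tensor_space.span
    and tensor_dependent = tensor_space.dependent
  by unfold_locales (auto simp: tensor_scale_def fun_eq_iff algebra_simps)


context complex_inner_product_space
begin

text \<open>\<open>\<alpha>\<sigma>\<close> is \<open>\<alpha> \<circ> \<sigma>\<close>.\<close>

definition symmetrized ::
    "nat \<Rightarrow> (nat \<Rightarrow> 'v) \<Rightarrow> (nat \<Rightarrow> nat) set \<Rightarrow> ((nat \<Rightarrow> nat) \<Rightarrow> complex) \<Rightarrow>
     (nat \<Rightarrow> nat) \<Rightarrow> (nat \<Rightarrow> 'v) \<Rightarrow> complex" where
  "symmetrized m e S \<phi> \<alpha> =
     tensor_scale (\<phi> id / of_nat (card S))
       (\<Sum>\<sigma>\<in>S. tensor_scale (\<phi> \<sigma>) (basis_tensor m e (\<alpha> \<circ> inv_into UNIV \<sigma>)))"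

definition symmetry_class ::
    "nat \<Rightarrow> (nat \<Rightarrow> 'v) \<Rightarrow> (nat \<Rightarrow> nat) set \<Rightarrow> ((nat \<Rightarrow> nat) \<Rightarrow> complex) \<Rightarrow>
     ((nat \<Rightarrow> 'v) \<Rightarrow> complex) set" where
  "symmetry_class m e S \<phi> = tensor_span (symmetrized m e S \<phi> ` Gamma m)"

definition is_o_basis ::
    "nat \<Rightarrow> (nat \<Rightarrow> 'v) \<Rightarrow> (nat \<Rightarrow> nat) set \<Rightarrow> ((nat \<Rightarrow> nat) \<Rightarrow> complex) \<Rightarrow>
     ((nat \<Rightarrow> 'v) \<Rightarrow> complex) set \<Rightarrow> ((nat \<Rightarrow> 'v) \<Rightarrow> complex) set \<Rightarrow> bool" where
  "is_o_basis m e S \<phi> W B \<longleftrightarrow>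
     B \<subseteq> symmetrized m e S \<phi> ` Gamma m \<and>
     (\<forall>F\<in>B. \<forall>H\<in>B. F \<noteq> H \<longrightarrow> tensor_ip m e F H = 0) \<and>
     \<not> tensor_dependent B \<and> tensor_span B = W"

definition has_o_basis ::
    "nat \<Rightarrow> (nat \<Rightarrow> 'v) \<Rightarrow> (nat \<Rightarrow> nat) set \<Rightarrow> ((nat \<Rightarrow> nat) \<Rightarrow> complex) \<Rightarrow>
     ((nat \<Rightarrow> 'v) \<Rightarrow> complex) set \<Rightarrow> bool" where
  "has_o_basis m e S \<phi> W \<longleftrightarrow> (\<exists>B. is_o_basis m e S \<phi> W B)"

lemma ip_add_right: "ip z (x + y) = ip z x + ip z y"
  by (metis ip_add_left ip_cnj complex_cnj_add)

lemma ip_zero_left [simp]: "ip 0 y = 0"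
  using ip_scale_left[of 0 0 y] by simp

lemma ip_sum_left: "ip (sum f A) z = (\<Sum>a\<in>A. ip (f a) z)"
  by (induction A rule: infinite_finite_induct) (auto simp: ip_add_left)

lemma parseval:
  assumes "orthonormal_basis e"
  shows "ip x y = (\<Sum>i\<in>{1..dim UNIV}. ip x (e i) * cnj (ip y (e i)))"
proof -
  let ?I = "{1..dim UNIV}"
  have on: "ip (e i) (e j) = (if i = j then 1 else 0)" if "i \<in> ?I" "j \<in> ?I" for i j
    using assms that unfolding orthonormal_basis_def by blast
  have "x \<in> span (e ` ?I)"
    using assms unfolding orthonormal_basis_def by blast
  then have "\<forall>y. ip x y = (\<Sum>i\<in>?I. ip x (e i) * cnj (ip y (e i)))"
  proof (induction rule: span_induct_alt)
    case base
    then show ?case by simp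
  next
    case (step c b z)
    then obtain j where j: "j \<in> ?I" "b = e j" by blast
    have ej: "ip (e j) y = (\<Sum>i\<in>?I. ip (e j) (e i) * cnj (ip y (e i)))" for y
    proof -
      have "(\<Sum>i\<in>?I. ip (e j) (e i) * cnj (ip y (e i)))
          = (\<Sum>i\<in>?I. if j = i then cnj (ip y (e i)) else 0)"
        using j by (intro sum.cong) (auto simp: on)
      also have "\<dots> = ip (e j) y"
        using j by (simp add: ip_cnj[of y "e j"])
      finally show ?thesis by simp
    qed
    have z: "ip z y = (\<Sum>i\<in>?I. ip z (e i) * cnj (ip y (e i)))" for y
      using step by blast
    have "ip (scale c b + z) y = (\<Sum>i\<in>?I. ip (scale c b + z) (e i) * cnj (ip y (e i)))" for y
    proof -
      have "ip (scale c b + z) y = c * ip (e j) y + ip z y"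
        by (simp only: ip_add_left ip_scale_left j(2))
      also have "\<dots> = (\<Sum>i\<in>?I. (c * ip (e j) (e i) + ip z (e i)) * cnj (ip y (e i)))"
        by (subst ej, subst z)
          (simp only: distrib_right sum.distrib sum_distrib_left mult.assoc)
      finally show ?thesis
        by (simp only: ip_add_left ip_scale_left j(2))
    qed
    then show ?case by blast
  qed
  then show ?thesis by blast
qed

lemma tensor_ip_tensor:
  assumes "orthonormal_basis e"
  shows "tensor_ip m e (tensor m x) (tensor m y) = (\<Prod>i=1..m. ip (x i) (y i))"
proof -
  let ?I = "{1..dim UNIV}"
  have "(\<Prod>i=1..m. ip (x i) (y i))
      = (\<Prod>i=1..m. \<Sum>j\<in>?I. ip (x i) (e j) * cnj (ip (y i) (e j)))"
    by (intro prod.cong refl parseval[OF assms])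
  also have "\<dots> = (\<Sum>\<alpha>\<in>Gamma m. \<Prod>i=1..m. ip (x i) (e (\<alpha> i)) * cnj (ip (y i) (e (\<alpha> i))))"
    unfolding Gamma_def by (subst prod_sum_PiE) auto
  finally show ?thesis
    by (simp add: tensor_ip_def tensor_def prod.distrib)
qed

end

end

theory Submission
  imports Defs
begin

text \<open>Let \<open>G\<close> be the dicyclic group and \<open>S\<close> its set of \<open>p\<close>-regular elements.

  \<^bold>\<open>Existence.\<close>  An o-basis exists as soon as any two symmetrized tensors are orthogonal or
  proportional: a maximal orthogonal set of nonzero ones is then a basis
  (\<open>has_o_basis_if_orthogonal_or_proportional\<close>).  In dimension \<open>1\<close> there is only one symmetrized
  tensor.  If \<open>S\<close> is a subgroup, the symmetrized tensors of an \<open>S\<close>-orbit are proportional and those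
  of different orbits are orthogonal; this covers \<open>p \<nmid> 2n\<close>, where \<open>S = G\<close>, and \<open>p = 2\<close>, where \<open>S\<close>
  consists of the powers of \<open>r\<close> of odd order.

  \<^bold>\<open>Non-existence.\<close>  Let \<open>p\<close> be an odd prime divisor of \<open>2n\<close> and \<open>dim V \<ge> 2\<close>.  As \<open>G\<close> acts regularly on the
  \<open>4n\<close> points, the sequence \<open>\<alpha> = (1, 2, \<dots>, 2)\<close> has trivial stabilizer, and the symmetrized tensors of
  its orbit, read as functions on \<open>G\<close>, are up to unimodular factors and a fixed scalar the indicator
  functions of the right translates \<open>Sg\<close>, twisted by the linear character \<open>\<chi>\<close>.  The inner product of two of
  them is nonzero if and only if the translates meet.  All elements \<open>s r\<^sup>j\<close> have order dividing \<open>4\<close>,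
  so \<open>S\<close> contains all elements outside the subgroup generated by \<open>r\<close>, and therefore any two
  translates of \<open>S\<close> meet (\<open>p_regular_dicyclic_translates_meet\<close>).  An o-basis could thus contain at most one tensor of the orbit, so the
  symmetrized tensors of the orbit would all be proportional and all translates of \<open>S\<close> would be
  equal, forcing \<open>S = G\<close> (\<open>no_o_basis_if_translates_meet\<close>).  But the order \<open>2n\<close> of \<open>r\<close> is divisible by \<open>p\<close>.\<close>

section \<open>Permutation groups\<close>

lemma subgroup_sym_groupD:
  assumes "subgroup G (sym_group m)"
  shows "id \<in> G"
    and "g \<in> G \<Longrightarrow> g permutes {1..m}"
    and "g \<in> G \<Longrightarrow> h \<in> G \<Longrightarrow> g \<circ> h \<in> G"
    and "g \<in> G \<Longrightarrow> inv' g \<in> G"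
    and "finite G"
proof -
  interpret subgroup G "sym_group m" by fact
  show 1: "id \<in> G"
    using one_closed by (simp add: sym_group_one)
  show 2: "g permutes {1..m}" if "g \<in> G" for g
    using mem_carrier[OF that] by (simp add: sym_group_carrier)
  show "g \<circ> h \<in> G" if "g \<in> G" "h \<in> G"
    using m_closed[OF that] by (simp add: sym_group_mult)
  show "inv' g \<in> G" if "g \<in> G"
    using m_inv_closed[OF that] sym_group_inv_equality[OF mem_carrier[OF that]] by simp
  have "G \<subseteq> {g. g permutes {1..m}}"
    using 2 by blast
  then show "finite G"
    by (rule finite_subset) (simp add: finite_permutations)
qed

lemma complex_character:
  assumes "\<chi> \<in> hom ((sym_group m) \<lparr>carrier := G\<rparr>) complex_units"
  shows "g \<in> G \<Longrightarrow> h \<in> G \<Longrightarrow> \<chi> (g \<circ> h) = \<chi> g * \<chi> h"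
    and "g \<in> G \<Longrightarrow> \<chi> g \<noteq> 0"
  using assms by (auto simp: hom_def complex_units_def sym_group_mult Pi_iff)


section \<open>Coordinates of symmetrized tensors\<close>

text \<open>As tensors are conjugate-multilinear forms, this value is the inner product with the basis tensor
  of \<open>\<gamma>\<close>.\<close>

definition coordinate ::
    "(nat \<Rightarrow> 'v) \<Rightarrow> ((nat \<Rightarrow> 'v) \<Rightarrow> complex) \<Rightarrow> (nat \<Rightarrow> nat) \<Rightarrow> complex" where
  "coordinate e F \<gamma> = F (\<lambda>i. e (\<gamma> i))"

lemma coordinate_linear [simp]:
  "coordinate e (F + H) \<gamma> = coordinate e F \<gamma> + coordinate e H \<gamma>"
  "coordinate e (tensor_scale c F) \<gamma> = c * coordinate e F \<gamma>"
  "coordinate e 0 \<gamma> = 0"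
  by (auto simp: coordinate_def tensor_scale_def)

lemma coordinate_sum [simp]: "coordinate e (sum f I) \<gamma> = (\<Sum>i\<in>I. coordinate e (f i) \<gamma>)"
  by (induction I rule: infinite_finite_induct) (auto simp: coordinate_def)

context complex_inner_product_space
begin

lemma finite_Gamma: "finite (Gamma m)"
  unfolding Gamma_def by (intro finite_PiE) auto

lemma Gamma_permute:
  assumes "\<alpha> \<in> Gamma m" "g permutes {1..m}"
  shows "\<alpha> \<circ> g \<in> Gamma m"
proof -
  have "g i \<in> {1..m} \<longleftrightarrow> i \<in> {1..m}" for i
    using permutes_in_image[OF assms(2)] .
  then show ?thesis
    using assms(1) unfolding Gamma_def PiE_def Pi_def extensional_def by auto
qed

lemma tensor_ip_coordinates:
  "tensor_ip m e F H = (\<Sum>\<gamma>\<in>Gamma m. coordinate e F \<gamma> * cnj (coordinate e H \<gamma>))"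
  by (simp add: tensor_ip_def coordinate_def)

lemma tensor_ip_sum_left:
  "tensor_ip m e (\<Sum>i\<in>I. tensor_scale (c i) (F i)) H = (\<Sum>i\<in>I. c i * tensor_ip m e (F i) H)"
proof -
  have "tensor_ip m e (\<Sum>i\<in>I. tensor_scale (c i) (F i)) H
      = (\<Sum>\<gamma>\<in>Gamma m. \<Sum>i\<in>I. c i * (coordinate e (F i) \<gamma> * cnj (coordinate e H \<gamma>)))"
    by (simp add: tensor_ip_coordinates sum_distrib_right mult.assoc)
  also have "\<dots> = (\<Sum>i\<in>I. \<Sum>\<gamma>\<in>Gamma m. c i * (coordinate e (F i) \<gamma> * cnj (coordinate e H \<gamma>)))"
    by (rule sum.swap)
  finally show ?thesis
    by (simp add: tensor_ip_coordinates sum_distrib_left)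
qed

lemma tensor_ip_cnj: "tensor_ip m e H F = cnj (tensor_ip m e F H)"
  by (simp add: tensor_ip_coordinates mult.commute)

lemma coordinate_basis_tensor:
  assumes "orthonormal_basis e" "\<alpha> \<in> Gamma m" "\<gamma> \<in> Gamma m"
  shows "coordinate e (basis_tensor m e \<alpha>) \<gamma> = of_bool (\<alpha> = \<gamma>)"
proof -
  have "ip (e (\<alpha> i)) (e (\<gamma> i)) = of_bool (\<alpha> i = \<gamma> i)" if "i \<in> {1..m}" for i
  proof -
    have "\<alpha> i \<in> {1..dim UNIV}" "\<gamma> i \<in> {1..dim UNIV}"
      using assms(2,3) that by (auto simp: Gamma_def)
    then show ?thesis
      using assms(1) unfolding orthonormal_basis_def by simp
  qed
  then have "coordinate e (basis_tensor m e \<alpha>) \<gamma> = (\<Prod>i=1..m. of_bool (\<alpha> i = \<gamma> i))"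
    by (simp add: coordinate_def basis_tensor_def tensor_def)
  also have "\<dots> = of_bool (\<forall>i\<in>{1..m}. \<alpha> i = \<gamma> i)"
    by (auto simp: prod_zero_iff)
  also have "(\<forall>i\<in>{1..m}. \<alpha> i = \<gamma> i) \<longleftrightarrow> \<alpha> = \<gamma>"
    using assms(2,3) by (auto simp: Gamma_def intro: PiE_ext)
  finally show ?thesis .
qed

lemma coordinate_symmetrized:
  assumes e: "orthonormal_basis e" and S: "S \<subseteq> carrier (sym_group m)"
    and \<alpha>: "\<alpha> \<in> Gamma m" and \<gamma>: "\<gamma> \<in> Gamma m"
  shows "coordinate e (symmetrized m e S \<phi> \<alpha>) \<gamma>
    = \<phi> id / of_nat (card S) * (\<Sum>\<sigma>\<in>S. \<phi> \<sigma> * of_bool (\<alpha> \<circ> inv' \<sigma> = \<gamma>))"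
proof -
  have "\<alpha> \<circ> inv' \<sigma> \<in> Gamma m" if "\<sigma> \<in> S" for \<sigma>
    using S that by (intro Gamma_permute[OF \<alpha>] permutes_inv) (auto simp: sym_group_carrier)
  then show ?thesis
    by (simp add: symmetrized_def coordinate_basis_tensor[OF e _ \<gamma>])
qed

text \<open>A tensor is determined by its coordinates only inside the span of the basis tensors; an
  arbitrary function on \<open>m\<close>-tuples of vectors need not be conjugate-multilinear.\<close>

lemma symmetrized_eq_0I:
  assumes e: "orthonormal_basis e" and S: "S \<subseteq> carrier (sym_group m)" and \<alpha>: "\<alpha> \<in> Gamma m"
    and 0: "\<And>\<gamma>. \<gamma> \<in> Gamma m \<Longrightarrow> coordinate e (symmetrized m e S \<phi> \<alpha>) \<gamma> = 0"
  shows "symmetrized m e S \<phi> \<alpha> = 0"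
proof -
  let ?c = "\<phi> id / of_nat (card S)"
  have in\<Gamma>: "\<alpha> \<circ> inv' \<sigma> \<in> Gamma m" if "\<sigma> \<in> S" for \<sigma>
    using S that by (intro Gamma_permute[OF \<alpha>] permutes_inv) (auto simp: sym_group_carrier)
  have "symmetrized m e S \<phi> \<alpha> y = 0" for y
  proof -
    have "basis_tensor m e (\<alpha> \<circ> inv' \<sigma>) y
        = (\<Sum>\<gamma>\<in>Gamma m. of_bool (\<alpha> \<circ> inv' \<sigma> = \<gamma>) * basis_tensor m e \<gamma> y)" if "\<sigma> \<in> S" for \<sigma>
      using in\<Gamma>[OF that] finite_Gamma by (simp add: of_bool_def if_distrib[of "\<lambda>c. c * _"] cong: if_cong)
    moreover have "sum f I y = (\<Sum>i\<in>I. f i y)" for f :: "(nat \<Rightarrow> nat) \<Rightarrow> (nat \<Rightarrow> 'v) \<Rightarrow> complex" and I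
      by (induction I rule: infinite_finite_induct) auto
    ultimately have "symmetrized m e S \<phi> \<alpha> y
        = ?c * (\<Sum>\<sigma>\<in>S. \<Sum>\<gamma>\<in>Gamma m. \<phi> \<sigma> * of_bool (\<alpha> \<circ> inv' \<sigma> = \<gamma>) * basis_tensor m e \<gamma> y)"
      by (simp add: symmetrized_def tensor_scale_def sum_distrib_left sum_divide_distrib mult.assoc)
    also have "(\<Sum>\<sigma>\<in>S. \<Sum>\<gamma>\<in>Gamma m. \<phi> \<sigma> * of_bool (\<alpha> \<circ> inv' \<sigma> = \<gamma>) * basis_tensor m e \<gamma> y)
        = (\<Sum>\<gamma>\<in>Gamma m. \<Sum>\<sigma>\<in>S. \<phi> \<sigma> * of_bool (\<alpha> \<circ> inv' \<sigma> = \<gamma>) * basis_tensor m e \<gamma> y)"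
      by (rule sum.swap)
    also have "?c * \<dots> = (\<Sum>\<gamma>\<in>Gamma m.
        coordinate e (symmetrized m e S \<phi> \<alpha>) \<gamma> * basis_tensor m e \<gamma> y)"
      unfolding sum_distrib_left[of ?c]
      by (intro sum.cong refl)
        (simp add: coordinate_symmetrized[OF e S \<alpha>] sum_distrib_left sum_distrib_right mult.assoc)
    also have "\<dots> = 0"
      by (simp add: 0)
    finally show ?thesis .
  qed
  then show ?thesis
    by (simp add: fun_eq_iff)
qed

lemma symmetrized_tensor_ip_nonzero:
  assumes e: "orthonormal_basis e" and S: "S \<subseteq> carrier (sym_group m)" and \<alpha>: "\<alpha> \<in> Gamma m"
    and nz: "symmetrized m e S \<phi> \<alpha> \<noteq> 0"
  shows "tensor_ip m e (symmetrized m e S \<phi> \<alpha>) (symmetrized m e S \<phi> \<alpha>) \<noteq> 0"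
proof
  let ?F = "symmetrized m e S \<phi> \<alpha>"
  assume "tensor_ip m e ?F ?F = 0"
  then have "(\<Sum>\<gamma>\<in>Gamma m. complex_of_real ((cmod (coordinate e ?F \<gamma>))\<^sup>2)) = 0"
    by (simp add: tensor_ip_coordinates complex_norm_square del: of_real_power)
  then have "(\<Sum>\<gamma>\<in>Gamma m. (cmod (coordinate e ?F \<gamma>))\<^sup>2) = 0"
    by (simp flip: of_real_sum del: of_real_power)
  then have "\<forall>\<gamma>\<in>Gamma m. coordinate e ?F \<gamma> = 0"
    by (subst (asm) sum_nonneg_eq_0_iff) (auto simp: finite_Gamma)
  then have "?F = 0"
    by (intro symmetrized_eq_0I[OF e S \<alpha>]) auto
  with nz show False by contradiction
qed


section \<open>Existence of o-bases\<close>

text \<open>A maximal orthogonal set of nonzero symmetrized tensors spans: by maximality every other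
  nonzero symmetrized tensor fails to be orthogonal to some member of the set, hence is a multiple
  of it.\<close>

lemma has_o_basis_if_orthogonal_or_proportional:
  assumes e: "orthonormal_basis e" and S: "S \<subseteq> carrier (sym_group m)"
    and dichotomy: "\<And>\<alpha> \<beta>. \<alpha> \<in> Gamma m \<Longrightarrow> \<beta> \<in> Gamma m \<Longrightarrow>
      tensor_ip m e (symmetrized m e S \<phi> \<alpha>) (symmetrized m e S \<phi> \<beta>) = 0 \<or>
      symmetrized m e S \<phi> \<alpha> \<in> tensor_span {symmetrized m e S \<phi> \<beta>}"
  shows "has_o_basis m e S \<phi> (symmetry_class m e S \<phi>)"
proof -
  define P where "P = symmetrized m e S \<phi> ` Gamma m"
  define orth where "orth B \<longleftrightarrow> (\<forall>F\<in>B. \<forall>H\<in>B. F \<noteq> H \<longrightarrow> tensor_ip m e F H = 0)" for B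
  have "finite P"
    by (simp add: P_def finite_Gamma)
  have "finite {B. B \<subseteq> P - {0} \<and> orth B}"
    by (rule finite_subset[of _ "Pow P"]) (use \<open>finite P\<close> in auto)
  moreover have "{B. B \<subseteq> P - {0} \<and> orth B} \<noteq> {}"
    by (auto simp: orth_def intro: exI[of _ "{}"])
  ultimately have "\<exists>B\<in>{B. B \<subseteq> P - {0} \<and> orth B}. \<forall>B'\<in>{B. B \<subseteq> P - {0} \<and> orth B}.
      B \<subseteq> B' \<longrightarrow> B = B'"
    by (rule finite_has_maximal)
  then obtain B where B: "B \<subseteq> P - {0}" "orth B"
    and max: "\<And>B'. B' \<subseteq> P - {0} \<Longrightarrow> orth B' \<Longrightarrow> B \<subseteq> B' \<Longrightarrow> B = B'"
    by auto
  have "finite B"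
    using B(1) \<open>finite P\<close> by (meson finite_Diff finite_subset)
  have self: "tensor_ip m e H H \<noteq> 0" if "H \<in> B" for H
    using that B(1) symmetrized_tensor_ip_nonzero[OF e S] by (auto simp: P_def)
  have "\<not> tensor_dependent B"
  proof
    assume "tensor_dependent B"
    then obtain u H where u: "(\<Sum>F\<in>B. tensor_scale (u F) F) = 0" and H: "H \<in> B" "u H \<noteq> 0"
      using tensor_space.dependent_finite[OF \<open>finite B\<close>] by blast
    have "0 = tensor_ip m e (\<Sum>F\<in>B. tensor_scale (u F) F) H"
      by (simp add: u tensor_ip_coordinates)
    also have "\<dots> = (\<Sum>F\<in>B. u F * tensor_ip m e F H)"
      by (rule tensor_ip_sum_left)
    also have "\<dots> = (\<Sum>F\<in>B. if F = H then u H * tensor_ip m e H H else 0)"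
      using B(2) H(1) by (intro sum.cong refl) (auto simp: orth_def)
    also have "\<dots> = u H * tensor_ip m e H H"
      using \<open>finite B\<close> H(1) by simp
    finally show False
      using self H by simp
  qed
  moreover have "F \<in> tensor_span B" if F: "F \<in> P" for F
  proof (cases "F = 0 \<or> F \<in> B")
    case True
    then show ?thesis
      using tensor_space.span_zero tensor_space.span_base by blast
  next
    case False
    then have "\<not> orth (insert F B)"
      using max[of "insert F B"] F B(1) by auto
    then have "\<exists>H\<in>B. tensor_ip m e F H \<noteq> 0 \<or> tensor_ip m e H F \<noteq> 0"
      using B(2) unfolding orth_def by blast
    then obtain H where H: "H \<in> B" "tensor_ip m e F H \<noteq> 0"
      using tensor_ip_cnj[of m e F] by auto
    have "H \<in> P"
      using B(1) H(1) by blast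
    then obtain \<alpha> \<beta> where "\<alpha> \<in> Gamma m" "F = symmetrized m e S \<phi> \<alpha>"
        "\<beta> \<in> Gamma m" "H = symmetrized m e S \<phi> \<beta>"
      using F unfolding P_def by blast
    then have "F \<in> tensor_span {H}"
      using dichotomy[of \<alpha> \<beta>] H(2) by auto
    then show ?thesis
      using tensor_space.span_mono[of "{H}" B] H(1) by blast
  qed
  then have "tensor_span B = tensor_span P"
    using B(1) tensor_space.span_superset[of P] by (subst tensor_space.span_eq) auto
  ultimately have "is_o_basis m e S \<phi> (symmetry_class m e S \<phi>) B"
    using B unfolding is_o_basis_def symmetry_class_def orth_def P_def by blast
  then show ?thesis
    unfolding has_o_basis_def by blast
qed

text \<open>Substituting \<open>\<sigma> \<mapsto> \<sigma>\<tau>\<close> in the defining sum shows that the symmetrized tensors of one orbit are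
  proportional, while those of different orbits involve different basis tensors.\<close>

lemma has_o_basis_subgroup:
  assumes e: "orthonormal_basis e" and S: "subgroup S (sym_group m)"
    and \<chi>: "\<chi> \<in> hom ((sym_group m) \<lparr>carrier := S\<rparr>) complex_units"
  shows "has_o_basis m e S \<chi> (symmetry_class m e S \<chi>)"
proof (rule has_o_basis_if_orthogonal_or_proportional[OF e subgroup.subset[OF S]])
  fix \<alpha> \<beta>
  assume \<alpha>: "\<alpha> \<in> Gamma m" and \<beta>: "\<beta> \<in> Gamma m"
  note S' = subgroup_sym_groupD[OF S] and \<chi>' = complex_character[OF \<chi>]
  have bij: "bij \<sigma>" if "\<sigma> \<in> S" for \<sigma>
    using S'(2)[OF that] by (rule permutes_bij)
  show "tensor_ip m e (symmetrized m e S \<chi> \<alpha>) (symmetrized m e S \<chi> \<beta>) = 0 \<or>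
      symmetrized m e S \<chi> \<alpha> \<in> tensor_span {symmetrized m e S \<chi> \<beta>}"
  proof (cases "\<exists>\<tau>\<in>S. \<alpha> = \<beta> \<circ> inv' \<tau>")
    case True
    then obtain \<tau> where \<tau>: "\<tau> \<in> S" "\<alpha> = \<beta> \<circ> inv' \<tau>" by blast
    let ?t = "\<lambda>\<sigma>. basis_tensor m e (\<beta> \<circ> inv' \<sigma>)"
    have "(\<Sum>\<sigma>\<in>S. tensor_scale (\<chi> \<sigma>) (basis_tensor m e (\<alpha> \<circ> inv' \<sigma>)))
        = (\<Sum>\<sigma>\<in>S. tensor_scale (inverse (\<chi> \<tau>)) (tensor_scale (\<chi> (\<sigma> \<circ> \<tau>)) (?t (\<sigma> \<circ> \<tau>))))"
      using \<tau> by (intro sum.cong refl ext)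
        (simp add: tensor_scale_def o_inv_distrib bij comp_assoc \<chi>')
    also have "\<dots> = tensor_scale (inverse (\<chi> \<tau>))
        (\<Sum>\<sigma>\<in>S. tensor_scale (\<chi> (\<sigma> \<circ> \<tau>)) (?t (\<sigma> \<circ> \<tau>)))"
      by (rule tensor_space.scale_sum_right[symmetric])
    also have "(\<Sum>\<sigma>\<in>S. tensor_scale (\<chi> (\<sigma> \<circ> \<tau>)) (?t (\<sigma> \<circ> \<tau>)))
        = (\<Sum>\<sigma>\<in>S. tensor_scale (\<chi> \<sigma>) (?t \<sigma>))"
    proof (rule sum.reindex_bij_witness[where i = "\<lambda>\<sigma>. \<sigma> \<circ> inv' \<tau>" and j = "\<lambda>\<sigma>. \<sigma> \<circ> \<tau>"])
      fix \<sigma> assume \<sigma>: "\<sigma> \<in> S"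
      show "\<sigma> \<circ> \<tau> \<circ> inv' \<tau> = \<sigma>" "\<sigma> \<circ> inv' \<tau> \<circ> \<tau> = \<sigma>"
        using permutes_inv_o[OF S'(2)[OF \<tau>(1)]] by (simp_all add: comp_assoc)
      show "\<sigma> \<circ> inv' \<tau> \<in> S" "\<sigma> \<circ> \<tau> \<in> S"
        using S'(3,4) \<sigma> \<tau>(1) by blast+
    qed simp
    finally have "symmetrized m e S \<chi> \<alpha> = tensor_scale (inverse (\<chi> \<tau>)) (symmetrized m e S \<chi> \<beta>)"
      by (simp only: symmetrized_def tensor_space.scale_scale mult.commute)
    then show ?thesis
      by (simp add: tensor_space.span_base tensor_space.span_scale)
  next
    case False
    have no: "\<not> (\<alpha> \<circ> inv' \<sigma> = \<gamma> \<and> \<beta> \<circ> inv' \<tau> = \<gamma>)" if "\<sigma> \<in> S" "\<tau> \<in> S" for \<sigma> \<tau> \<gamma>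
    proof
      assume "\<alpha> \<circ> inv' \<sigma> = \<gamma> \<and> \<beta> \<circ> inv' \<tau> = \<gamma>"
      then have "\<alpha> \<circ> (inv' \<sigma> \<circ> \<sigma>) = \<beta> \<circ> inv' \<tau> \<circ> \<sigma>"
        by (simp flip: comp_assoc)
      then have "\<alpha> = \<beta> \<circ> inv' (inv' \<sigma> \<circ> \<tau>)"
        using permutes_inv_o[OF S'(2)[OF that(1)]] bij that
        by (simp add: o_inv_distrib bij_imp_bij_inv inv_inv_eq comp_assoc)
      moreover have "inv' \<sigma> \<circ> \<tau> \<in> S"
        using S'(3,4) that by blast
      ultimately show False
        using False by blast
    qed
    have "coordinate e (symmetrized m e S \<chi> \<alpha>) \<gamma> = 0 \<or> coordinate e (symmetrized m e S \<chi> \<beta>) \<gamma> = 0"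
      if "\<gamma> \<in> Gamma m" for \<gamma>
    proof (cases "\<exists>\<sigma>\<in>S. \<alpha> \<circ> inv' \<sigma> = \<gamma>")
      case True
      then have "\<forall>\<tau>\<in>S. \<beta> \<circ> inv' \<tau> \<noteq> \<gamma>"
        using no by blast
      then show ?thesis
        by (simp add: coordinate_symmetrized[OF e subgroup.subset[OF S] \<beta> that])
    next
      case False
      then show ?thesis
        by (simp add: coordinate_symmetrized[OF e subgroup.subset[OF S] \<alpha> that])
    qed
    then have "tensor_ip m e (symmetrized m e S \<chi> \<alpha>) (symmetrized m e S \<chi> \<beta>) = 0"
      unfolding tensor_ip_coordinates by (intro sum.neutral) auto
    then show ?thesis by blast
  qed
qed

lemma has_o_basis_dim_1:
  assumes e: "orthonormal_basis e" and S: "S \<subseteq> carrier (sym_group m)"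
    and dim: "dim UNIV = 1"
  shows "has_o_basis m e S \<phi> (symmetry_class m e S \<phi>)"
proof (rule has_o_basis_if_orthogonal_or_proportional[OF e S])
  fix \<alpha> \<beta>
  assume "\<alpha> \<in> Gamma m" "\<beta> \<in> Gamma m"
  then have "\<alpha> = \<beta>"
    unfolding Gamma_def dim PiE_def Pi_def by (auto intro!: extensionalityI)
  then show "tensor_ip m e (symmetrized m e S \<phi> \<alpha>) (symmetrized m e S \<phi> \<beta>) = 0 \<or>
      symmetrized m e S \<phi> \<alpha> \<in> tensor_span {symmetrized m e S \<phi> \<beta>}"
    by (simp add: tensor_space.span_base)
qed


section \<open>Non-existence of o-bases\<close>

text \<open>A trivial stabilizer identifies the orbit of \<open>\<alpha>\<close> with \<open>G\<close>.  The factor \<open>\<chi> k * \<chi> (inv' g)\<close> is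
  \<open>\<chi> (k \<circ> inv' g)\<close>, so up to a constant the coordinates of the symmetrized tensor of \<open>g\<close> form the right
  translate by \<open>g\<close> of \<open>\<chi>\<close> restricted to \<open>S\<close>.\<close>

lemma coordinate_regular_orbit:
  assumes e: "orthonormal_basis e" and G: "subgroup G (sym_group m)"
    and \<chi>: "\<chi> \<in> hom ((sym_group m) \<lparr>carrier := G\<rparr>) complex_units"
    and SG: "S \<subseteq> G"
    and \<alpha>: "\<alpha> \<in> Gamma m" and stab: "\<And>g. g \<in> G \<Longrightarrow> \<alpha> \<circ> g = \<alpha> \<Longrightarrow> g = id"
    and g: "g \<in> G" and k: "k \<in> G"
  shows "coordinate e (symmetrized m e S \<chi> (\<alpha> \<circ> inv' g)) (\<alpha> \<circ> inv' k)
    = of_bool (k \<circ> inv' g \<in> S) * (\<chi> id / of_nat (card S) * \<chi> k * \<chi> (inv' g))"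
proof -
  note G' = subgroup_sym_groupD[OF G] and \<chi>' = complex_character[OF \<chi>]
  have inv: "h \<circ> inv' h = id" "inv' h \<circ> h = id" "bij h" if "h \<in> G" for h
    using permutes_inv_o[OF G'(2)[OF that]] permutes_bij[OF G'(2)[OF that]] by auto
  have "finite S"
    using SG G'(5) finite_subset by blast
  have iff: "\<alpha> \<circ> inv' g \<circ> inv' \<sigma> = \<alpha> \<circ> inv' k \<longleftrightarrow> \<sigma> = k \<circ> inv' g" if "\<sigma> \<in> S" for \<sigma>
  proof
    have \<sigma>: "\<sigma> \<in> G" using that SG by blast
    assume "\<alpha> \<circ> inv' g \<circ> inv' \<sigma> = \<alpha> \<circ> inv' k"
    then have "\<alpha> \<circ> inv' g \<circ> inv' \<sigma> \<circ> k = \<alpha>"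
      using inv(2)[OF k] by (simp add: comp_assoc)
    then have "inv' g \<circ> inv' \<sigma> \<circ> k = id"
      using stab[of "inv' g \<circ> inv' \<sigma> \<circ> k"] G'(3,4) g \<sigma> k by (simp add: comp_assoc)
    then have "(\<sigma> \<circ> (g \<circ> inv' g) \<circ> inv' \<sigma>) \<circ> k = \<sigma> \<circ> g"
      by (metis comp_assoc comp_id)
    then have "k = \<sigma> \<circ> g"
      using inv g \<sigma> by simp
    then show "\<sigma> = k \<circ> inv' g"
      using inv(1)[OF g] by (simp add: comp_assoc)
  next
    assume "\<sigma> = k \<circ> inv' g"
    then have "k = \<sigma> \<circ> g"
      using inv(2)[OF g] by (simp add: comp_assoc)
    then show "\<alpha> \<circ> inv' g \<circ> inv' \<sigma> = \<alpha> \<circ> inv' k"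
      using inv(3) g that SG by (auto simp: o_inv_distrib comp_assoc)
  qed
  have \<Gamma>: "\<alpha> \<circ> inv' h \<in> Gamma m" if "h \<in> G" for h
    by (intro Gamma_permute[OF \<alpha>] permutes_inv G'(2) that)
  have S: "S \<subseteq> carrier (sym_group m)"
    using SG subgroup.subset[OF G] by blast
  have "(\<Sum>\<sigma>\<in>S. \<chi> \<sigma> * of_bool (\<alpha> \<circ> inv' g \<circ> inv' \<sigma> = \<alpha> \<circ> inv' k))
      = (\<Sum>\<sigma>\<in>S. if \<sigma> = k \<circ> inv' g then \<chi> (k \<circ> inv' g) else 0)"
    by (intro sum.cong refl) (auto simp: iff)
  also have "\<dots> = of_bool (k \<circ> inv' g \<in> S) * (\<chi> k * \<chi> (inv' g))"
    using \<open>finite S\<close> \<chi>'(1)[OF k G'(4)[OF g]] by simp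
  finally show ?thesis
    by (simp add: coordinate_symmetrized[OF e S \<Gamma>[OF g] \<Gamma>[OF k]])
qed

text \<open>If the right translates of \<open>S\<close> meet pairwise, the symmetrized tensors of a regular orbit are
  pairwise non-orthogonal: the inner product of the translates by \<open>g\<close> and \<open>h\<close> is a nonzero multiple
  of the positive number \<open>\<Sum>\<^sub>k |\<chi> k|\<^sup>2\<close>, \<open>k\<close> in the intersection of the two translates of \<open>S\<close>.\<close>

lemma regular_orbit_not_orthogonal:
  assumes e: "orthonormal_basis e" and G: "subgroup G (sym_group m)"
    and \<chi>: "\<chi> \<in> hom ((sym_group m) \<lparr>carrier := G\<rparr>) complex_units"
    and SG: "S \<subseteq> G"
    and \<alpha>: "\<alpha> \<in> Gamma m" and stab: "\<And>g. g \<in> G \<Longrightarrow> \<alpha> \<circ> g = \<alpha> \<Longrightarrow> g = id"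
    and meet: "\<And>k. k \<in> G \<Longrightarrow> \<exists>\<sigma>\<in>S. \<sigma> \<circ> k \<in> S"
    and g: "g \<in> G" and h: "h \<in> G"
  shows "tensor_ip m e (symmetrized m e S \<chi> (\<alpha> \<circ> inv' g)) (symmetrized m e S \<chi> (\<alpha> \<circ> inv' h)) \<noteq> 0"
proof -
  note G' = subgroup_sym_groupD[OF G] and \<chi>' = complex_character[OF \<chi>]
  define c where "c = \<chi> id / of_nat (card S)"
  define K where "K = {k \<in> G. k \<circ> inv' g \<in> S \<and> k \<circ> inv' h \<in> S}"
  let ?F = "coordinate e (symmetrized m e S \<chi> (\<alpha> \<circ> inv' g))"
  let ?H = "coordinate e (symmetrized m e S \<chi> (\<alpha> \<circ> inv' h))"
  have S: "S \<subseteq> carrier (sym_group m)"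
    using SG subgroup.subset[OF G] by blast
  have "finite S"
    using SG G'(5) finite_subset by blast
  have inv: "a \<circ> inv' a = id" "inv' a \<circ> a = id" "bij a" if "a \<in> G" for a
    using permutes_inv_o[OF G'(2)[OF that]] permutes_bij[OF G'(2)[OF that]] by auto
  have \<Gamma>: "\<alpha> \<circ> inv' a \<in> Gamma m" if "a \<in> G" for a
    by (intro Gamma_permute[OF \<alpha>] permutes_inv G'(2) that)
  have inj: "inj_on (\<lambda>k. \<alpha> \<circ> inv' k) G"
  proof (rule inj_onI)
    fix k l assume kl: "k \<in> G" "l \<in> G" "\<alpha> \<circ> inv' k = \<alpha> \<circ> inv' l"
    then have "\<alpha> \<circ> (inv' k \<circ> l) = \<alpha>"
      using inv(2)[of l] by (metis comp_assoc comp_id)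
    then have "inv' k \<circ> l = id"
      using stab G'(3,4) kl by blast
    then have "k \<circ> inv' k \<circ> l = k"
      by (simp add: comp_assoc)
    then show "k = l"
      using inv(1) kl by simp
  qed
  have outside: "?F \<gamma> = 0" if \<gamma>: "\<gamma> \<in> Gamma m - (\<lambda>k. \<alpha> \<circ> inv' k) ` G" for \<gamma>
  proof -
    have "\<alpha> \<circ> inv' g \<circ> inv' \<sigma> \<noteq> \<gamma>" if "\<sigma> \<in> S" for \<sigma>
    proof -
      have "\<alpha> \<circ> inv' g \<circ> inv' \<sigma> = \<alpha> \<circ> inv' (\<sigma> \<circ> g)"
        using inv(3) g that SG by (auto simp: o_inv_distrib comp_assoc)
      then show ?thesis
        using \<gamma> G'(3) g that SG by auto
    qed
    then show ?thesis
      using \<gamma> by (simp add: coordinate_symmetrized[OF e S \<Gamma>[OF g]])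
  qed
  have "tensor_ip m e (symmetrized m e S \<chi> (\<alpha> \<circ> inv' g)) (symmetrized m e S \<chi> (\<alpha> \<circ> inv' h))
      = (\<Sum>\<gamma>\<in>(\<lambda>k. \<alpha> \<circ> inv' k) ` G. ?F \<gamma> * cnj (?H \<gamma>))"
    unfolding tensor_ip_coordinates
    by (intro sum.mono_neutral_right finite_Gamma) (use \<Gamma> outside in auto)
  also have "\<dots> = (\<Sum>k\<in>G. ?F (\<alpha> \<circ> inv' k) * cnj (?H (\<alpha> \<circ> inv' k)))"
    using inj by (simp add: sum.reindex)
  also have "\<dots> = (\<Sum>k\<in>G. if k \<in> K then
      (c * cnj c * \<chi> (inv' g) * cnj (\<chi> (inv' h))) * of_real ((cmod (\<chi> k))\<^sup>2) else 0)"
    by (intro sum.cong refl)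
      (auto simp: coordinate_regular_orbit[OF e G \<chi> SG \<alpha> stab] g h K_def c_def
         complex_norm_square simp del: of_real_power)
  also have "\<dots> = (\<Sum>k\<in>K.
      (c * cnj c * \<chi> (inv' g) * cnj (\<chi> (inv' h))) * of_real ((cmod (\<chi> k))\<^sup>2))"
    using G'(5) by (auto simp: K_def sum.If_cases intro!: sum.cong)
  also have "\<dots> = (c * cnj c * \<chi> (inv' g) * cnj (\<chi> (inv' h)))
      * of_real (\<Sum>k\<in>K. (cmod (\<chi> k))\<^sup>2)"
    by (simp add: sum_distrib_left)
  finally have ip: "tensor_ip m e (symmetrized m e S \<chi> (\<alpha> \<circ> inv' g))
        (symmetrized m e S \<chi> (\<alpha> \<circ> inv' h))
      = (c * cnj c * \<chi> (inv' g) * cnj (\<chi> (inv' h))) * of_real (\<Sum>k\<in>K. (cmod (\<chi> k))\<^sup>2)" .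
  obtain \<sigma> where \<sigma>: "\<sigma> \<in> S" "\<sigma> \<circ> (g \<circ> inv' h) \<in> S"
    using meet[of "g \<circ> inv' h"] G'(3,4) g h by blast
  have "\<sigma> \<circ> g \<in> K"
    using \<sigma> SG G'(3) g inv(1)[OF g] by (auto simp: K_def comp_assoc)
  then have "(\<Sum>k\<in>K. (cmod (\<chi> k))\<^sup>2) > 0"
    using G'(5) \<chi>'(2) by (intro sum_pos) (auto simp: K_def)
  moreover have "c \<noteq> 0"
    using \<chi>'(2)[OF G'(1)] \<sigma>(1) \<open>finite S\<close> by (auto simp: c_def)
  ultimately show ?thesis
    using \<chi>'(2) G'(4) g h by (simp add: ip del: of_real_sum of_real_power)
qed

text \<open>By the previous lemma an o-basis contains at most one symmetrized tensor \<open>F\<^sub>0\<close> of a regular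
  orbit, so on that orbit all elements of the symmetry class are multiples of \<open>F\<^sub>0\<close>.  The supports of
  the symmetrized tensors of the orbit, that is the right translates of \<open>S\<close>, then all agree, which
  forces \<open>S = G\<close>.\<close>

lemma no_o_basis_if_translates_meet:
  assumes e: "orthonormal_basis e" and G: "subgroup G (sym_group m)"
    and \<chi>: "\<chi> \<in> hom ((sym_group m) \<lparr>carrier := G\<rparr>) complex_units"
    and SG: "S \<subset> G" and "id \<in> S"
    and \<alpha>: "\<alpha> \<in> Gamma m" and stab: "\<And>g. g \<in> G \<Longrightarrow> \<alpha> \<circ> g = \<alpha> \<Longrightarrow> g = id"
    and meet: "\<And>k. k \<in> G \<Longrightarrow> \<exists>\<sigma>\<in>S. \<sigma> \<circ> k \<in> S"
  shows "\<not> has_o_basis m e S \<chi> (symmetry_class m e S \<chi>)"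
proof
  note G' = subgroup_sym_groupD[OF G] and \<chi>' = complex_character[OF \<chi>]
  let ?f = "symmetrized m e S \<chi>"
  define Orb where "Orb = (\<lambda>g. \<alpha> \<circ> inv' g) ` G"
  have SG': "S \<subseteq> G" and S: "S \<subseteq> carrier (sym_group m)"
    using SG subgroup.subset[OF G] by blast+
  have "finite S"
    using SG' G'(5) finite_subset by blast
  have bij: "bij a" if "a \<in> G" for a
    using permutes_bij[OF G'(2)[OF that]] .
  have \<Gamma>: "\<alpha> \<circ> inv' a \<in> Gamma m" if "a \<in> G" for a
    by (intro Gamma_permute[OF \<alpha>] permutes_inv G'(2) that)
  assume "has_o_basis m e S \<chi> (symmetry_class m e S \<chi>)"
  then obtain B where B: "B \<subseteq> ?f ` Gamma m"
      and orth: "\<And>F H. F \<in> B \<Longrightarrow> H \<in> B \<Longrightarrow> F \<noteq> H \<Longrightarrow> tensor_ip m e F H = 0"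
      and span: "tensor_span B = tensor_span (?f ` Gamma m)"
    unfolding has_o_basis_def is_o_basis_def symmetry_class_def by blast
  have "\<exists>F\<^sub>0. \<forall>F\<in>B \<inter> ?f ` Orb. F = F\<^sub>0"
    using orth regular_orbit_not_orthogonal[OF e G \<chi> SG' \<alpha> stab meet]
    unfolding Orb_def by blast
  then obtain F\<^sub>0 where F\<^sub>0: "\<And>F. F \<in> B \<Longrightarrow> F \<in> ?f ` Orb \<Longrightarrow> F = F\<^sub>0"
    by blast
  \<comment> \<open>If \<open>B\<close> contains no tensor of the orbit, \<open>F\<^sub>0\<close> is arbitrary, and the elements of \<open>B\<close> lie in \<open>W\<close>
    with \<open>c = 0\<close>.\<close>
  define W where "W = {F. \<exists>c. \<forall>\<gamma>\<in>Orb. coordinate e F \<gamma> = c * coordinate e F\<^sub>0 \<gamma>}"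
  have "F \<in> W" if F: "F \<in> B" for F
  proof (cases "F \<in> ?f ` Orb")
    case True
    then have "F = F\<^sub>0"
      using F\<^sub>0 F by blast
    then show ?thesis
      unfolding W_def by (auto intro: exI[of _ 1])
  next
    case False
    obtain \<beta> where \<beta>: "\<beta> \<in> Gamma m" "F = ?f \<beta>"
      using B F by blast
    have "coordinate e F (\<alpha> \<circ> inv' k) = 0" if k: "k \<in> G" for k
    proof -
      have "\<beta> \<circ> inv' \<sigma> \<noteq> \<alpha> \<circ> inv' k" if \<sigma>: "\<sigma> \<in> S" for \<sigma>
      proof
        assume "\<beta> \<circ> inv' \<sigma> = \<alpha> \<circ> inv' k"
        then have "\<beta> \<circ> (inv' \<sigma> \<circ> \<sigma>) = \<alpha> \<circ> (inv' k \<circ> \<sigma>)"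
          by (simp flip: comp_assoc)
        moreover have "inv' k \<circ> \<sigma> = inv' (inv' \<sigma> \<circ> k)"
          using bij \<sigma> k SG' by (auto simp: o_inv_distrib bij_imp_bij_inv inv_inv_eq)
        ultimately have "\<beta> = \<alpha> \<circ> inv' (inv' \<sigma> \<circ> k)"
          using permutes_inv_o(2)[OF G'(2)] \<sigma> SG' by auto
        moreover have "inv' \<sigma> \<circ> k \<in> G"
          using G'(3,4) \<sigma> k SG' by blast
        ultimately show False
          using False \<beta>(2) unfolding Orb_def by blast
      qed
      then show ?thesis
        by (simp add: \<beta>(2) coordinate_symmetrized[OF e S \<beta>(1) \<Gamma>[OF k]])
    qed
    then show ?thesis
      unfolding W_def Orb_def by (auto intro: exI[of _ 0])
  qed
  moreover have "tensor_space.subspace W"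
  proof (rule tensor_space.subspaceI)
    show "0 \<in> W"
      unfolding W_def by (auto intro: exI[of _ 0])
    show "F + H \<in> W" if "F \<in> W" "H \<in> W" for F H
      using that unfolding W_def by (auto simp flip: distrib_right)
    show "tensor_scale c F \<in> W" if "F \<in> W" for c F
      using that unfolding W_def by (auto simp flip: mult.assoc)
  qed
  ultimately have "tensor_span B \<subseteq> W"
    by (intro tensor_space.span_minimal) auto
  then have inW: "?f (\<alpha> \<circ> inv' g) \<in> W" if "g \<in> G" for g
    using \<Gamma>[OF that] unfolding span by (blast intro: tensor_space.span_base)
  have "\<chi> id / of_nat (card S) \<noteq> 0"
    using \<chi>'(2)[OF G'(1)] \<open>id \<in> S\<close> \<open>finite S\<close> by auto
  then have supp: "coordinate e (?f (\<alpha> \<circ> inv' g)) (\<alpha> \<circ> inv' k) \<noteq> 0 \<longleftrightarrow> k \<circ> inv' g \<in> S"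
    if "g \<in> G" "k \<in> G" for g k
    using \<chi>'(2) G'(4) that by (simp add: coordinate_regular_orbit[OF e G \<chi> SG' \<alpha> stab])
  have translate: "k \<circ> inv' g \<in> S \<longleftrightarrow> coordinate e F\<^sub>0 (\<alpha> \<circ> inv' k) \<noteq> 0"
    if g: "g \<in> G" and k: "k \<in> G" for g k
  proof -
    obtain c where c: "\<And>l. l \<in> G \<Longrightarrow>
        coordinate e (?f (\<alpha> \<circ> inv' g)) (\<alpha> \<circ> inv' l) = c * coordinate e F\<^sub>0 (\<alpha> \<circ> inv' l)"
      using inW[OF g] unfolding W_def Orb_def by blast
    have "g \<circ> inv' g \<in> S"
      using permutes_inv_o(1)[OF G'(2)[OF g]] \<open>id \<in> S\<close> by simp
    then have "c \<noteq> 0"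
      using supp[OF g g] c[OF g] by auto
    then show ?thesis
      using supp[OF g k] c[OF k] by simp
  qed
  \<comment> \<open>For \<open>k = g\<close>, both \<open>k \<circ> inv' g = id \<in> S\<close> and, with \<open>id\<close> in place of \<open>g\<close>, \<open>k \<in> S\<close> say that
    \<open>F\<^sub>0\<close> does not vanish at \<open>k\<close>.\<close>
  have "g \<in> S" if g: "g \<in> G" for g
    using translate[OF g g] translate[OF G'(1) g] permutes_inv_o(1)[OF G'(2)[OF g]] \<open>id \<in> S\<close>
    by simp
  then show False
    using SG by blast
qed

end


section \<open>The dicyclic group\<close>

lemma cycle_of_list_upt:
  assumes "a \<le> x" "x < b"
  shows "cycle_of_list [a..<b] x = (if Suc x = b then a else Suc x)"
proof -
  have x: "x = [a..<b] ! (x - a)" and len: "x - a < length [a..<b]"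
    using assms by auto
  have "cycle_of_list [a..<b] x = map (cycle_of_list [a..<b]) [a..<b] ! (x - a)"
    using x len by simp
  also have "\<dots> = rotate1 [a..<b] ! (x - a)"
    using cyclic_rotation[of "[a..<b]" 1] by simp
  also have "\<dots> = [a..<b] ! (Suc (x - a) mod (b - a))"
    using len by (simp add: nth_rotate1)
  also have "\<dots> = (if Suc x = b then a else Suc x)"
    using assms by (cases "Suc x = b") (auto simp: Suc_diff_le simp del: upt_Suc)
  finally show ?thesis .
qed

lemma dic_r_apply:
  "dic_r n x = (if x \<in> {1..2*n} then (if x = 2*n then 1 else Suc x)
    else if x \<in> {2*n+1..4*n} then (if x = 4*n then 2*n+1 else Suc x) else x)"
proof -
  have out: "cycle_of_list [a..<b] y = y" if "y < a \<or> b \<le> y" for a b y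
    using that by (intro id_outside_supp) auto
  show ?thesis
    by (auto simp: dic_r_def out cycle_of_list_upt simp del: upt_Suc)
qed

text \<open>Writing the points \<open>1, \<dots>, 2n\<close> as \<open>(a, 0)\<close> and \<open>2n+1, \<dots>, 4n\<close> as \<open>(a, 1)\<close>, where \<open>a\<close> is a residue
  modulo \<open>2n\<close> counted from \<open>0\<close>, the generator \<open>r\<close> adds \<open>1\<close> to \<open>a\<close>.\<close>

lemma dic_r_funpow:
  "(dic_r n ^^ k) x = (if x \<in> {1..2*n} then (x - 1 + k) mod (2*n) + 1
    else if x \<in> {2*n+1..4*n} then (x - (2*n+1) + k) mod (2*n) + (2*n+1) else x)"
proof (induction k)
  case 0
  then show ?case by auto
next
  case (Suc k)
  have step: "(dic_r n ^^ Suc k) x = dic_r n ((dic_r n ^^ k) x)"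
    by simp
  consider "x \<in> {1..2*n}" | "x \<in> {2*n+1..4*n}" | "x = 0 \<or> x > 4*n"
    by force
  then show ?case
  proof cases
    case 1
    define y where "y = (x - 1 + k) mod (2*n)"
    have "y < 2*n" "(dic_r n ^^ k) x = y + 1"
      using 1 Suc.IH by (auto simp: y_def)
    moreover have "(x - 1 + Suc k) mod (2*n) = (if Suc y = 2*n then 0 else Suc y)"
      by (simp add: mod_Suc y_def)
    ultimately show ?thesis
      unfolding step using 1 by (auto simp: dic_r_apply)
  next
    case 2
    define y where "y = (x - (2*n+1) + k) mod (2*n)"
    have "y < 2*n" "(dic_r n ^^ k) x = y + (2*n+1)"
      using 2 Suc.IH by (auto simp: y_def)
    moreover have "(x - (2*n+1) + Suc k) mod (2*n) = (if Suc y = 2*n then 0 else Suc y)"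
      by (simp add: mod_Suc y_def)
    ultimately show ?thesis
      unfolding step using 2 by (auto simp: dic_r_apply)
  next
    case 3
    then have "(dic_r n ^^ k) x = x"
      using Suc.IH by auto
    then show ?thesis
      unfolding step using 3 by (auto simp: dic_r_apply)
  qed
qed

lemma foldr_disjoint_permutations:
  assumes "distinct xs"
    and "\<And>i. i \<in> set xs \<Longrightarrow> c i permutes A i"
    and "\<And>i j. i \<in> set xs \<Longrightarrow> j \<in> set xs \<Longrightarrow> i \<noteq> j \<Longrightarrow> A i \<inter> A j = {}"
  shows "(\<forall>i\<in>set xs. \<forall>x\<in>A i. foldr (\<circ>) (map c xs) id x = c i x) \<and>
    (\<forall>x. x \<notin> (\<Union>i\<in>set xs. A i) \<longrightarrow> foldr (\<circ>) (map c xs) id x = x)"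
  using assms
proof (induction xs)
  case Nil
  then show ?case by simp
next
  case (Cons j xs)
  let ?f = "foldr (\<circ>) (map c xs) id"
  have IH: "\<And>i x. i \<in> set xs \<Longrightarrow> x \<in> A i \<Longrightarrow> ?f x = c i x"
    "\<And>x. x \<notin> (\<Union>i\<in>set xs. A i) \<Longrightarrow> ?f x = x"
  proof -
    have "(\<forall>i\<in>set xs. \<forall>x\<in>A i. ?f x = c i x) \<and> (\<forall>x. x \<notin> (\<Union>i\<in>set xs. A i) \<longrightarrow> ?f x = x)"
      by (rule Cons.IH) (use Cons.prems in auto)
    then show "\<And>i x. i \<in> set xs \<Longrightarrow> x \<in> A i \<Longrightarrow> ?f x = c i x"
      "\<And>x. x \<notin> (\<Union>i\<in>set xs. A i) \<Longrightarrow> ?f x = x"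
      by blast+
  qed
  have c: "c j permutes A j" and disj: "\<And>i. i \<in> set xs \<Longrightarrow> A i \<inter> A j = {}"
    using Cons.prems by auto
  have "c j (?f x) = c i x" if i: "i \<in> set (j # xs)" and x: "x \<in> A i" for i x
  proof (cases "i = j")
    case True
    then have "?f x = x"
      using x disj by (intro IH(2)) auto
    then show ?thesis
      using True by simp
  next
    case False
    then have "i \<in> set xs" "c i x \<in> A i"
      using i x Cons.prems(2)[of i] permutes_in_image[of "c i" "A i" x] by auto
    then show ?thesis
      using IH(1)[of i x] x disj[of i] permutes_not_in[OF c, of "c i x"] by auto
  qed
  moreover have "c j (?f x) = x" if "x \<notin> (\<Union>i\<in>set (j # xs). A i)" for x
    using that IH(2)[of x] permutes_not_in[OF c, of x] by auto
  moreover have "foldr (\<circ>) (map c (j # xs)) id x = c j (?f x)" for x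
    by simp
  ultimately show ?case
    by metis
qed

text \<open>In the coordinates above, \<open>s\<close> maps \<open>(a, 0)\<close> to \<open>(-a, 1)\<close> and \<open>(a, 1)\<close> to \<open>(n - a, 0)\<close>; the case
  distinctions only reduce \<open>-a\<close> and \<open>n - a\<close> to the range from \<open>0\<close> to \<open>2n - 1\<close>.\<close>

lemma dic_s_apply:
  assumes n: "n \<ge> 1"
  shows "dic_s n x = (if x = 1 then 2*n+1 else if x \<in> {2..2*n} then 4*n+2-x
    else if x \<in> {2*n+1..3*n+1} then 3*n+2-x else if x \<in> {3*n+2..4*n} then 5*n+2-x else x)"
proof -
  define c where "c i = cycle_of_list [i, 4*n+2-i, n+i, 3*n+2-i]" for i
  define A where "A i = {i, 4*n+2-i, n+i, 3*n+2-i}" for i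
  let ?c1 = "cycle_of_list [1, 2*n+1, n+1, 3*n+1]"
  let ?f = "foldr (\<circ>) (map c [2..<n+1]) id"
  have s: "dic_s n x = ?c1 (?f x)" for x
    by (simp add: dic_s_def c_def[abs_def])
  have perm: "c i permutes A i" for i
    using cycle_permutes[of "[i, 4*n+2-i, n+i, 3*n+2-i]"] by (simp add: c_def A_def)
  have set: "set [2..<n+1] = {2..n}"
    by auto
  have "(\<forall>i\<in>set [2..<n+1]. \<forall>x\<in>A i. ?f x = c i x) \<and>
      (\<forall>x. x \<notin> (\<Union>i\<in>set [2..<n+1]. A i) \<longrightarrow> ?f x = x)"
    by (rule foldr_disjoint_permutations[OF _ perm]) (auto simp: A_def)
  then have f: "\<And>i x. i \<in> {2..n} \<Longrightarrow> x \<in> A i \<Longrightarrow> ?f x = c i x"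
      "\<And>x. x \<notin> (\<Union>i\<in>{2..n}. A i) \<Longrightarrow> ?f x = x"
    unfolding set by blast+
  have c1_out: "?c1 x = x" if "x \<notin> {1, 2*n+1, n+1, 3*n+1}" for x
    using that by (intro id_outside_supp) auto
  have c1: "?c1 1 = 2*n+1" "?c1 (2*n+1) = n+1" "?c1 (n+1) = 3*n+1" "?c1 (3*n+1) = 1"
    using n by (auto simp: transpose_def)
  have c: "c i i = 4*n+2-i" "c i (4*n+2-i) = n+i" "c i (n+i) = 3*n+2-i" "c i (3*n+2-i) = i"
    if "i \<in> {2..n}" for i
    using that by (auto simp: c_def transpose_def)
  have fc: "?f x = c i x" "?c1 (c i x) = c i x" if "i \<in> {2..n}" "x \<in> A i" for i x
  proof -
    show "?f x = c i x"
      using f(1) that by blast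
    have "c i x \<in> A i"
      using perm that(2) permutes_in_image by metis
    then show "?c1 (c i x) = c i x"
      using that(1) by (intro c1_out) (auto simp: A_def)
  qed
  have f_out: "?f x = x" if "x \<in> {1, 2*n+1, n+1, 3*n+1} \<or> x = 0 \<or> x > 4*n" for x
    by (rule f(2)) (use that n in \<open>auto simp: A_def\<close>)
  have on_A: "dic_s n i = 4*n+2-i" "dic_s n (4*n+2-i) = n+i" "dic_s n (n+i) = 3*n+2-i"
    "dic_s n (3*n+2-i) = i" if "i \<in> {2..n}" for i
  proof -
    have "dic_s n x = c i x" if "x \<in> A i" for x
      using fc[OF \<open>i \<in> {2..n}\<close> that] by (simp only: s)
    then show "dic_s n i = 4*n+2-i" "dic_s n (4*n+2-i) = n+i" "dic_s n (n+i) = 3*n+2-i"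
      "dic_s n (3*n+2-i) = i"
      using c[OF that] unfolding A_def by simp_all
  qed
  have "?f 1 = 1" "?f (2*n+1) = 2*n+1" "?f (n+1) = n+1" "?f (3*n+1) = 3*n+1"
    by (rule f_out, simp)+
  then have s1: "dic_s n 1 = 2*n+1" "dic_s n (2*n+1) = n+1" "dic_s n (n+1) = 3*n+1"
      "dic_s n (3*n+1) = 1"
    by (simp_all only: s c1)
  consider "x = 1" | "x = n+1" | "x = 2*n+1" | "x = 3*n+1" | "x = 0 \<or> x > 4*n"
    | "x \<in> {2..n}" | "x \<in> {n+2..2*n}" | "x \<in> {2*n+2..3*n}" | "x \<in> {3*n+2..4*n}"
    by force
  then show ?thesis
  proof cases
    case 5
    then have "?f x = x" "?c1 x = x"
      using f_out[of x] n by (auto intro!: c1_out)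
    then have "dic_s n x = x"
      by (simp only: s)
    then show ?thesis
      using 5 n by auto
  next
    case 6
    then show ?thesis using on_A(1)[of x] by auto
  next
    case 7
    then have "x - n \<in> {2..n}" "n + (x - n) = x"
      by auto
    then show ?thesis using on_A(3)[of "x - n"] 7 by auto
  next
    case 8
    then have "3*n+2-x \<in> {2..n}" "3*n+2-(3*n+2-x) = x"
      by auto
    then show ?thesis using on_A(4)[of "3*n+2-x"] 8 by auto
  next
    case 9
    then have "4*n+2-x \<in> {2..n}" "4*n+2-(4*n+2-x) = x"
      by auto
    then show ?thesis using on_A(2)[of "4*n+2-x"] 9 by auto
  qed (use s1 n in auto)
qed

text \<open>The last relation is \<open>s\<^sup>-\<^sup>1 r\<^sup>k s = r\<^sup>-\<^sup>k\<close>, written without inverses.\<close>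

lemma dicyclic_relations:
  assumes n: "n \<ge> 1"
  shows "dic_r n ^^ (2*n) = id"
    and "dic_s n \<circ> dic_s n = dic_r n ^^ n"
    and "dic_r n ^^ k \<circ> dic_s n \<circ> dic_r n ^^ k = dic_s n"
proof -
  have period: "(y + 2*n) mod (2*n) = y mod (2*n)" for y
    by simp
  show "dic_r n ^^ (2*n) = id"
  proof
    show "(dic_r n ^^ (2*n)) x = id x" for x
      unfolding dic_r_funpow period by auto
  qed
  note s = dic_s_apply[OF n]
  have s1: "dic_s n 1 = 2*n+1" and s2: "x \<in> {2..2*n} \<Longrightarrow> dic_s n x = 4*n+2-x"
    and s3: "x \<in> {2*n+1..3*n+1} \<Longrightarrow> dic_s n x = 3*n+2-x"
    and s4: "x \<in> {3*n+2..4*n} \<Longrightarrow> dic_s n x = 5*n+2-x"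
    and s0: "x = 0 \<or> x > 4*n \<Longrightarrow> dic_s n x = x" for x
    using n by (auto simp: s)
  have r1: "x \<in> {1..<2*n} \<or> x \<in> {2*n+1..<4*n} \<Longrightarrow> dic_r n x = Suc x"
    and r2: "dic_r n (2*n) = 1" "dic_r n (4*n) = 2*n+1"
    and r0: "x = 0 \<or> x > 4*n \<Longrightarrow> dic_r n x = x" for x
    using n by (auto simp: dic_r_apply)
  have half: "(y + n) mod (2*n) = (if y < n then y + n else y - n)" if "y < 2*n" for y
    using that by (auto simp: le_mod_geq)
  show "dic_s n \<circ> dic_s n = dic_r n ^^ n"
  proof
    fix x
    have "(dic_r n ^^ n) x = (if x \<in> {1..n} \<or> x \<in> {2*n+1..3*n} then x + n
        else if x \<in> {n+1..2*n} \<or> x \<in> {3*n+1..4*n} then x - n else x)"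
    proof -
      consider "x \<in> {1..2*n}" | "x \<in> {2*n+1..4*n}" | "x = 0 \<or> x > 4*n"
        by force
      then show ?thesis
      proof cases
        case 1
        then have "(x - 1 + n) mod (2*n) = (if x - 1 < n then x - 1 + n else x - 1 - n)"
          by (intro half) auto
        then show ?thesis
          unfolding dic_r_funpow using 1 by (simp split: if_splits) arith
      next
        case 2
        then have "(x - (2*n+1) + n) mod (2*n)
            = (if x - (2*n+1) < n then x - (2*n+1) + n else x - (2*n+1) - n)"
          by (intro half) auto
        then show ?thesis
          unfolding dic_r_funpow using 2 by (simp split: if_splits) arith
      next
        case 3
        then show ?thesis
          unfolding dic_r_funpow by auto
      qed
    qed
    moreover consider "x = 1" | "x \<in> {2..n}" | "x \<in> {n+1..2*n}" | "x \<in> {2*n+1..3*n}" | "x = 3*n+1"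
      | "x \<in> {3*n+2..4*n}" | "x = 0 \<or> x > 4*n"
      by force
    then have "dic_s n (dic_s n x) = (if x \<in> {1..n} \<or> x \<in> {2*n+1..3*n} then x + n
        else if x \<in> {n+1..2*n} \<or> x \<in> {3*n+1..4*n} then x - n else x)"
    proof cases
      case 1
      then show ?thesis using n by (simp add: s1 s3 del: One_nat_def)
    next
      case 2
      then have "4*n+2-x \<in> {3*n+2..4*n}" by auto
      then show ?thesis using 2 by (simp add: s2 s4)
    next
      case 3
      then consider "x = 1" "n = 1" | "x \<in> {2..2*n}" "4*n+2-x \<in> {2*n+1..3*n+1}"
        using n by force
      then show ?thesis
        using 3 by cases (auto simp: s2 s3)
    next
      case 4
      then have "3*n+2-x \<in> {2..2*n}" by auto
      then show ?thesis using 4 by (simp add: s3 s2)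
    next
      case 5
      then have "dic_s n x = 1" by (simp add: s3)
      then show ?thesis using 5 n by (simp add: s1 del: One_nat_def)
    next
      case 6
      then have "5*n+2-x \<in> {2..2*n}" by auto
      then show ?thesis using 6 by (simp add: s4 s2)
    next
      case 7
      then show ?thesis by (auto simp: s0)
    qed
    ultimately show "(dic_s n \<circ> dic_s n) x = (dic_r n ^^ n) x"
      by simp
  qed
  have "dic_r n \<circ> dic_s n \<circ> dic_r n = dic_s n"
  proof
    fix x
    consider "x = 1" | "x \<in> {2..<2*n}" | "x = 2*n" | "x \<in> {2*n+1..3*n}" | "x = 3*n+1"
      | "x \<in> {3*n+2..<4*n}" | "x = 4*n" | "x = 0 \<or> x > 4*n"
      by force
    then have "dic_r n (dic_s n (dic_r n x)) = dic_s n x"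
    proof cases
      case 1
      then show ?thesis
      proof (cases "n = 1")
        case False
        then have "Suc x \<in> {2..2*n}" "dic_r n x = Suc x"
          using 1 n by (auto intro: r1)
        then show ?thesis using 1 r2 by (simp add: s1[unfolded One_nat_def] s2)
      qed (simp add: dic_r_apply dic_s_apply)
    next
      case 2
      then have "dic_r n x = Suc x" "dic_s n (Suc x) = 4*n+2-Suc x" "dic_s n x = 4*n+2-x"
        by (auto simp: r1 s2)
      moreover have "dic_r n (4*n+2-Suc x) = Suc (4*n+2-Suc x)"
        using 2 by (intro r1) auto
      ultimately show ?thesis using 2 by (auto simp: Suc_diff_le)
    next
      case 3
      then show ?thesis using n by (simp add: r1 r2 s1 s2 del: One_nat_def)
    next
      case 4
      then have "dic_r n x = Suc x" "dic_s n (Suc x) = 3*n+2-Suc x" "dic_s n x = 3*n+2-x"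
        by (auto simp: r1 s3)
      moreover have "dic_r n (3*n+2-Suc x) = Suc (3*n+2-Suc x)"
        using 4 by (intro r1) auto
      ultimately show ?thesis using 4 by (auto simp: Suc_diff_le)
    next
      case 5
      show ?thesis
      proof (cases "n = 1")
        case False
        then have "dic_r n x = Suc x" "dic_s n (Suc x) = 2*n" "dic_s n x = 1"
          using 5 n by (auto simp: r1 s3 s4)
        then show ?thesis by (simp add: r2)
      qed (use 5 in \<open>simp add: dic_r_apply dic_s_apply\<close>)
    next
      case 6
      then have "dic_r n x = Suc x" "dic_s n (Suc x) = 5*n+2-Suc x" "dic_s n x = 5*n+2-x"
        by (auto simp: r1 s4)
      moreover have "dic_r n (5*n+2-Suc x) = Suc (5*n+2-Suc x)"
        using 6 by (intro r1) auto
      ultimately show ?thesis using 6 by (auto simp: Suc_diff_le)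
    next
      case 7
      then have "dic_r n x = 2*n+1" "dic_s n (2*n+1) = n+1"
        using n by (auto simp: r2 s3)
      moreover have "dic_r n (n+1) = (if n = 1 then 1 else n+2)"
        using n by (auto simp: dic_r_apply)
      moreover have "dic_s n x = (if n = 1 then 1 else n+2)"
        using n 7 by (auto simp: s)
      ultimately show ?thesis by simp
    next
      case 8
      then show ?thesis by (simp add: r0 s0)
    qed
    then show "(dic_r n \<circ> dic_s n \<circ> dic_r n) x = dic_s n x"
      by simp
  qed
  then show "dic_r n ^^ k \<circ> dic_s n \<circ> dic_r n ^^ k = dic_s n"
  proof (induction k)
    case (Suc k)
    have eq: "dic_r n ^^ Suc k \<circ> dic_s n \<circ> dic_r n ^^ Suc k
        = dic_r n \<circ> (dic_r n ^^ k \<circ> dic_s n \<circ> dic_r n ^^ k) \<circ> dic_r n"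
      by (simp add: comp_assoc funpow_Suc_right del: funpow.simps)
        (simp add: funpow_swap1 fun_eq_iff)
    show ?case
      by (simp only: eq Suc)
  qed simp
qed

lemma dicyclic_subgroup: "n \<ge> 1 \<Longrightarrow> subgroup (carrier (dicyclic n)) (sym_group (4*n))"
  unfolding dicyclic_def
  by (simp, intro group.generate_is_subgroup sym_group_is_group)
    (use dic_r_permutes dic_s_permutes in \<open>auto simp: sym_group_carrier\<close>)

lemma dic_r_in_dicyclic: "dic_r n \<in> carrier (dicyclic n)"
  and dic_s_in_dicyclic: "dic_s n \<in> carrier (dicyclic n)"
  by (auto simp: dicyclic_def intro: generate.incl)

text \<open>By the relations the powers of \<open>r\<close> and their left multiples by \<open>s\<close> are closed under composition
  and contain the inverses of the generators.\<close>

lemma dicyclic_elements: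
  assumes n: "n \<ge> 1" and g: "g \<in> carrier (dicyclic n)"
  obtains k where "g = dic_r n ^^ k" | k where "g = dic_s n \<circ> dic_r n ^^ k"
proof -
  let ?r = "dic_r n" and ?s = "dic_s n"
  note rel = dicyclic_relations[OF n]
  define E where "E = range (\<lambda>k. ?r ^^ k) \<union> range (\<lambda>k. ?s \<circ> ?r ^^ k)"
  have rE: "?r ^^ k \<in> E" and sE: "?s \<circ> ?r ^^ k \<in> E" for k
    by (auto simp: E_def)
  have add: "?r ^^ i \<circ> ?r ^^ j = ?r ^^ (i + j)" for i j
    by (simp add: funpow_add)
  have period: "?r ^^ (2*n*i) = id" for i
    by (simp only: rel(1) id_funpow funpow_mult[symmetric, where m = "2*n"])
  have swap: "?r ^^ i \<circ> ?s = ?s \<circ> ?r ^^ ((2*n-1)*i)" for i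
  proof -
    have "i + (2*n-1)*i = 2*n*i"
      using n by (cases n) auto
    then have "?r ^^ i \<circ> ?r ^^ ((2*n-1)*i) = id"
      by (simp only: add period)
    then have "?r ^^ i \<circ> ?s = ?r ^^ i \<circ> ?s \<circ> ?r ^^ i \<circ> ?r ^^ ((2*n-1)*i)"
      by (simp add: comp_assoc)
    then show ?thesis
      by (simp only: rel(3))
  qed
  have closed: "a \<circ> b \<in> E" if "a \<in> E" "b \<in> E" for a b
  proof -
    have 1: "?r ^^ i \<circ> ?r ^^ j \<in> E" for i j
      using rE by (simp only: add)
    have 2: "?s \<circ> ?r ^^ i \<circ> ?r ^^ j \<in> E" for i j
      using sE by (simp only: add comp_assoc)
    have 3: "?r ^^ i \<circ> (?s \<circ> ?r ^^ j) \<in> E" for i j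
      using 2 by (simp only: swap flip: comp_assoc)
    have "?s \<circ> ?r ^^ i \<circ> (?s \<circ> ?r ^^ j) = ?s \<circ> (?r ^^ i \<circ> ?s) \<circ> ?r ^^ j" for i j
      by (simp add: comp_assoc)
    also have "\<dots> i j = ?s \<circ> ?s \<circ> ?r ^^ ((2*n-1)*i) \<circ> ?r ^^ j" for i j
      by (simp only: swap comp_assoc)
    also have "\<dots> i j \<in> E" for i j
      using rE by (simp only: rel(2) add)
    finally have 4: "?s \<circ> ?r ^^ i \<circ> (?s \<circ> ?r ^^ j) \<in> E" for i j .
    obtain i j where "a = ?r ^^ i \<or> a = ?s \<circ> ?r ^^ i" "b = ?r ^^ j \<or> b = ?s \<circ> ?r ^^ j"
      using \<open>a \<in> E\<close> \<open>b \<in> E\<close> unfolding E_def by blast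
    then show ?thesis
      using 1[of i j] 2[of i j] 3[of i j] 4[of i j] by (elim disjE) (simp_all only:)
  qed
  have inv_r: "inv' ?r = ?r ^^ (2*n-1)"
  proof (rule inv_unique_comp)
    show "?r \<circ> ?r ^^ (2*n-1) = id"
      using rel(1) n by (cases "2*n") auto
    show "?r ^^ (2*n-1) \<circ> ?r = id"
      using rel(1) n by (cases "2*n") (auto simp: funpow_Suc_right simp del: funpow.simps)
  qed
  have inv_s: "inv' ?s = ?s \<circ> ?r ^^ n"
  proof (rule inv_unique_comp)
    have 2: "?r ^^ n \<circ> ?r ^^ n = id"
      using rel(1) by (simp add: add mult_2)
    show "?s \<circ> (?s \<circ> ?r ^^ n) = id"
      using 2 rel(2) by (simp flip: comp_assoc)
    show "?s \<circ> ?r ^^ n \<circ> ?s = id"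
      using 2 by (simp flip: rel(2) add: comp_assoc)
  qed
  have "g \<in> generate (sym_group (4*n)) {?r, ?s}"
    using g by (simp add: dicyclic_def)
  then have "g \<in> E"
  proof induction
    case one
    then show ?case
      using rE[of 0] by (simp only: sym_group_one funpow.simps)
  next
    case (incl h)
    then show ?case
      using rE[of 1] sE[of 0] by auto
  next
    case (inv h)
    then have "h \<in> carrier (sym_group (4*n))"
      using dic_r_permutes[of n] dic_s_permutes[OF n] by (auto simp: sym_group_carrier)
    then show ?case
      using inv rE[of "2*n-1"] sE[of n] by (metis inv_r inv_s insertE singletonD sym_group_inv_equality)
  next
    case (eng a b)
    then show ?case
      unfolding sym_group_mult by (intro closed)
  qed
  then show ?thesis
    using that by (auto simp: E_def)
qed

text \<open>The power \<open>r\<^sup>k\<close> moves the point \<open>1\<close> by \<open>k\<close> modulo \<open>2n\<close> within the first \<open>2n\<close> points, and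
  \<open>s r\<^sup>k\<close> moves it to one of the last \<open>2n\<close> points.\<close>

lemma dicyclic_fixing_1:
  assumes n: "n \<ge> 1"
  shows "g \<in> carrier (dicyclic n) \<Longrightarrow> g 1 = 1 \<Longrightarrow> g = id"
    and "(dic_s n \<circ> dic_r n ^^ k) 1 \<noteq> 1"
proof -
  have r1: "(dic_r n ^^ k) 1 = k mod (2*n) + 1" for k
    using n by (simp add: dic_r_funpow)
  have "dic_s n y \<noteq> 1" if "y \<in> {1..2*n}" for y
    using that n by (auto simp: dic_s_apply)
  moreover have "k mod (2*n) + 1 \<in> {1..2*n}" for k
    using n by (simp add: Suc_leI)
  ultimately show s: "(dic_s n \<circ> dic_r n ^^ k) 1 \<noteq> 1" for k
    by (simp add: r1 del: One_nat_def)
  assume g: "g \<in> carrier (dicyclic n)" and fix1: "g 1 = 1"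
  show "g = id"
    using n g
  proof (cases rule: dicyclic_elements)
    case (1 k)
    then have "2*n dvd k"
      using fix1 r1[of k] by (simp add: mod_eq_0_iff_dvd)
    then obtain q where "k = 2*n*q" ..
    then show ?thesis
      by (simp only: 1 dicyclic_relations(1)[OF n] id_funpow funpow_mult[symmetric, where m = "2*n"])
  next
    case (2 k)
    then show ?thesis
      using s fix1 by blast
  qed
qed

lemma dicyclic_ord_dvd_iff:
  assumes "n \<ge> 1" "g \<in> carrier (dicyclic n)"
  shows "group.ord (dicyclic n) g dvd k \<longleftrightarrow> g ^^ k = id"
proof -
  interpret group "dicyclic n"
    using assms(1) by (rule dicyclic_group)
  have one: "\<one>\<^bsub>dicyclic n\<^esub> = id" and mult: "(\<otimes>\<^bsub>dicyclic n\<^esub>) = (\<circ>)"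
    by (simp_all add: dicyclic_def sym_group_one sym_group_mult)
  have "g [^]\<^bsub>dicyclic n\<^esub> k = g ^^ k"
  proof (induction k)
    case (Suc k)
    then show ?case
      by (simp only: nat_pow_Suc mult funpow_Suc_right)
  qed (simp add: one)
  then show ?thesis
    using pow_eq_id[OF assms(2), of k] by (simp only: one)
qed

text \<open>The square of \<open>s r\<^sup>k\<close> is \<open>s (r\<^sup>k s r\<^sup>k) = s\<^sup>2 = r\<^sup>n\<close>.\<close>

lemma ord_dic_s_coset:
  assumes n: "n \<ge> 1" and g: "dic_s n \<circ> dic_r n ^^ k \<in> carrier (dicyclic n)"
  shows "group.ord (dicyclic n) (dic_s n \<circ> dic_r n ^^ k) dvd 4"
proof -
  let ?g = "dic_s n \<circ> dic_r n ^^ k"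
  note rel = dicyclic_relations[OF n]
  have "?g \<circ> ?g = dic_s n \<circ> (dic_r n ^^ k \<circ> dic_s n \<circ> dic_r n ^^ k)"
    by (simp add: comp_assoc)
  also have "\<dots> = dic_r n ^^ n"
    by (simp only: rel)
  finally have gg: "?g \<circ> ?g = dic_r n ^^ n" .
  have "?g ^^ 4 = (?g \<circ> ?g) \<circ> (?g \<circ> ?g)"
    by (simp add: numeral_eq_Suc comp_assoc)
  also have "\<dots> = dic_r n ^^ (n + n)"
    by (simp only: gg funpow_add)
  also have "\<dots> = id"
    using rel(1) by (simp add: mult_2)
  finally show ?thesis
    using dicyclic_ord_dvd_iff[OF n g] by blast
qed

lemma ord_dic_r:
  assumes n: "n \<ge> 1"
  shows "group.ord (dicyclic n) (dic_r n) = 2*n"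
proof (rule dvd_antisym)
  interpret group "dicyclic n"
    using n by (rule dicyclic_group)
  note iff = dicyclic_ord_dvd_iff[OF n dic_r_in_dicyclic]
  show "ord (dic_r n) dvd 2*n"
    using iff dicyclic_relations(1)[OF n] by blast
  have "(dic_r n ^^ ord (dic_r n)) 1 = 1"
    using iff[of "ord (dic_r n)"] by simp
  then show "2*n dvd ord (dic_r n)"
    using n by (simp add: dic_r_funpow mod_eq_0_iff_dvd)
qed


section \<open>The \<open>p\<close>-regular elements\<close>

lemma id_p_regular_dicyclic:
  assumes "n \<ge> 1" "prime p"
  shows "id \<in> p_regular (dicyclic n) p"
proof -
  interpret group "dicyclic n"
    using \<open>n \<ge> 1\<close> by (rule dicyclic_group)
  have "\<not> p dvd ord \<one>\<^bsub>dicyclic n\<^esub>"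
    using prime_gt_1_nat[OF \<open>prime p\<close>] by (simp only: ord_id) auto
  then have "\<one>\<^bsub>dicyclic n\<^esub> \<in> p_regular (dicyclic n) p"
    by (simp only: p_regular_def one_closed mem_Collect_eq simp_thms)
  then show ?thesis
    by (simp add: dicyclic_def sym_group_one)
qed

lemma p_regular_dicyclic_coprime:
  assumes n: "n \<ge> 1" and p: "prime p" "\<not> p dvd 2*n"
  shows "p_regular (dicyclic n) p = carrier (dicyclic n)"
proof -
  have "\<not> p dvd 4"
    using p prime_dvd_mult_iff[of p 2 2] by auto
  have "\<not> p dvd group.ord (dicyclic n) g" if g: "g \<in> carrier (dicyclic n)" for g
    using n g
  proof (cases rule: dicyclic_elements)
    case (1 k)
    then have "g ^^ (2*n) = (dic_r n ^^ (2*n)) ^^ k"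
      by (simp only: funpow_mult mult.commute)
    then have "g ^^ (2*n) = id"
      by (simp only: dicyclic_relations(1)[OF n] id_funpow)
    then show ?thesis
      using dicyclic_ord_dvd_iff[OF n g] p(2) dvd_trans by blast
  next
    case (2 k)
    then show ?thesis
      using ord_dic_s_coset[OF n] g \<open>\<not> p dvd 4\<close> dvd_trans by blast
  qed
  then show ?thesis
    by (auto simp: p_regular_def)
qed

text \<open>An element of odd order is a power of \<open>r\<close>, and in the abelian group of these powers a product of
  elements of odd order has odd order.\<close>

lemma p_regular_dicyclic_2:
  assumes n: "n \<ge> 1"
  shows "subgroup (p_regular (dicyclic n) 2) (sym_group (4*n))"
proof -
  interpret G: group "dicyclic n"
    using n by (rule dicyclic_group)
  have one: "\<one>\<^bsub>dicyclic n\<^esub> = id"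
    by (simp add: dicyclic_def sym_group_one)
  have mult: "(\<otimes>\<^bsub>dicyclic n\<^esub>) = (\<circ>)"
    by (simp add: dicyclic_def sym_group_mult)
  have rot: "\<exists>k. g = dic_r n ^^ k" if g: "g \<in> p_regular (dicyclic n) 2" for g
  proof -
    have gG: "g \<in> carrier (dicyclic n)" and odd: "odd (G.ord g)"
      using g by (auto simp: p_regular_def)
    show ?thesis
      using n gG
    proof (cases rule: dicyclic_elements)
      case (2 k)
      then have "G.ord g dvd 2 * 2"
        using ord_dic_s_coset[OF n] gG by simp
      moreover have "coprime (G.ord g) (2 * 2)"
        using odd by (subst coprime_mult_right_iff) simp
      ultimately have "G.ord g dvd 1"
        by (meson coprime_common_divisor dvd_refl)
      then have "g = id"
        using G.ord_eq_1[OF gG] by (simp add: one)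
      then show ?thesis
        using 2 dicyclic_fixing_1(2)[OF n, of k] by simp
    qed blast
  qed
  have "subgroup (p_regular (dicyclic n) 2) (dicyclic n)"
  proof (rule G.subgroupI)
    show "p_regular (dicyclic n) 2 \<noteq> {}"
      using G.ord_id G.one_closed unfolding p_regular_def by fastforce
    fix a assume a: "a \<in> p_regular (dicyclic n) 2"
    then show "inv\<^bsub>dicyclic n\<^esub> a \<in> p_regular (dicyclic n) 2"
      by (simp add: p_regular_def)
    fix b assume b: "b \<in> p_regular (dicyclic n) 2"
    obtain i j where "a = dic_r n ^^ i" "b = dic_r n ^^ j"
      using rot a b by blast
    then have "a \<circ> b = b \<circ> a"
      by (simp flip: funpow_add add: add.commute)
    then have "G.ord (a \<circ> b) dvd G.ord a * G.ord b"
      using G.ord_mul_divides[of a b] a b by (simp add: mult p_regular_def)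
    moreover have "odd (G.ord a * G.ord b)"
      using a b by (simp add: p_regular_def)
    ultimately have "odd (G.ord (a \<circ> b))"
      by (meson dvd_trans)
    then show "a \<otimes>\<^bsub>dicyclic n\<^esub> b \<in> p_regular (dicyclic n) 2"
      using a b G.m_closed[of a b] by (simp add: p_regular_def mult)
  qed (auto simp: p_regular_def)
  then show ?thesis
    using group.incl_subgroup[OF sym_group_is_group dicyclic_subgroup[OF n]]
    by (simp add: dicyclic_def)
qed

text \<open>Given \<open>k\<close>, one of \<open>\<sigma> = s\<close> and \<open>\<sigma> = id\<close> works: \<open>k\<close> is a power of \<open>r\<close> in the first case and not in
  the second, so in both cases \<open>\<sigma>k\<close> is of the form \<open>s r\<^sup>j\<close> and has order dividing \<open>4\<close>.\<close>

lemma p_regular_dicyclic_translates_meet: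
  assumes n: "n \<ge> 1" and p: "prime p" "p \<noteq> 2" and k: "k \<in> carrier (dicyclic n)"
  shows "\<exists>\<sigma>\<in>p_regular (dicyclic n) p. \<sigma> \<circ> k \<in> p_regular (dicyclic n) p"
proof -
  have "\<not> p dvd 4"
    using p prime_dvd_mult_iff[of p 2 2] primes_dvd_imp_eq[OF p(1) two_is_prime_nat] by auto
  then have coset: "g \<in> p_regular (dicyclic n) p"
    if "g = dic_s n \<circ> dic_r n ^^ j" "g \<in> carrier (dicyclic n)" for g j
    using ord_dic_s_coset[OF n] that dvd_trans unfolding p_regular_def by blast
  show ?thesis
    using n k
  proof (cases rule: dicyclic_elements)
    case (1 j)
    have "dic_s n \<circ> k \<in> carrier (dicyclic n)"
      using subgroup_sym_groupD(3)[OF dicyclic_subgroup[OF n] dic_s_in_dicyclic k] .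
    then have "dic_s n \<circ> k \<in> p_regular (dicyclic n) p"
      using coset 1 by blast
    moreover have "dic_s n \<in> p_regular (dicyclic n) p"
      using coset[of _ 0] dic_s_in_dicyclic by simp
    ultimately show ?thesis by blast
  next
    case (2 j)
    show ?thesis
      using coset[OF 2 k] id_p_regular_dicyclic[OF n p(1)] by (auto intro: bexI[of _ id])
  qed
qed


section \<open>O-bases of the symmetry classes\<close>

lemma (in complex_inner_product_space) symmetrized_restrict:
  assumes "id \<in> S"
  shows "symmetrized m e S (restrict \<chi> S) = symmetrized m e S \<chi>"
  using assms by (auto simp: symmetrized_def fun_eq_iff intro!: sum.cong)

theorem theorem4p2:
  fixes scale :: "complex \<Rightarrow> 'v::ab_group_add \<Rightarrow> 'v"
    and ip :: "'v \<Rightarrow> 'v \<Rightarrow> complex"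
    and e :: "nat \<Rightarrow> 'v"
    and n p \<epsilon> h :: nat
    and \<chi> \<phi> :: "(nat \<Rightarrow> nat) \<Rightarrow> complex"
  assumes "complex_inner_product_space scale ip"
    and "complex_inner_product_space.finite_dimensional scale"
    and "\<exists>v::'v. v \<noteq> 0"
    and "complex_inner_product_space.orthonormal_basis scale ip e"
    and "n \<ge> 1"
    and "prime p"
    and "\<epsilon> = (if p \<noteq> 2 then 4 else 1)"
    and "h < \<epsilon>"
    and "is_dic_char n h \<chi>"
    and "\<phi> = restrict \<chi> (p_regular (dicyclic n) p)"
  shows "complex_inner_product_space.has_o_basis scale ip (4*n) e (p_regular (dicyclic n) p) \<phi>
           (complex_inner_product_space.symmetry_class scale ip (4*n) e
              (p_regular (dicyclic n) p) \<phi>)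
         \<longleftrightarrow> vector_space.dim scale (UNIV :: 'v set) = 1 \<or> p = 2 \<or> \<not> p dvd 2 * n"
proof -
  interpret complex_inner_product_space scale ip
    by fact
  let ?G = "carrier (dicyclic n)" and ?S = "p_regular (dicyclic n) p"
  note n = \<open>n \<ge> 1\<close> and p = \<open>prime p\<close> and e = \<open>orthonormal_basis e\<close>
  note G = dicyclic_subgroup[OF n]
  have \<chi>: "\<chi> \<in> hom ((sym_group (4*n)) \<lparr>carrier := ?G\<rparr>) complex_units"
    using \<open>is_dic_char n h \<chi>\<close> by (simp add: is_dic_char_def dicyclic_def)
  have SG: "?S \<subseteq> ?G"
    by (auto simp: p_regular_def)
  have "id \<in> ?S"
    by (rule id_p_regular_dicyclic[OF n p])
  then have sym: "symmetrized (4*n) e ?S \<phi> = symmetrized (4*n) e ?S \<chi>"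
    using symmetrized_restrict \<open>\<phi> = restrict \<chi> ?S\<close> by blast
  have \<phi>\<chi>: "has_o_basis (4*n) e ?S \<phi> (symmetry_class (4*n) e ?S \<phi>) \<longleftrightarrow>
      has_o_basis (4*n) e ?S \<chi> (symmetry_class (4*n) e ?S \<chi>)"
    unfolding has_o_basis_def is_o_basis_def symmetry_class_def sym ..
  show ?thesis
    unfolding \<phi>\<chi>
  proof
    assume "dim UNIV = 1 \<or> p = 2 \<or> \<not> p dvd 2 * n"
    then consider "dim UNIV = 1" | "subgroup ?S (sym_group (4*n))"
      using p_regular_dicyclic_2[OF n] p_regular_dicyclic_coprime[OF n p] G by auto
    then show "has_o_basis (4*n) e ?S \<chi> (symmetry_class (4*n) e ?S \<chi>)"
    proof cases
      case 1
      then show ?thesis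
        using SG subgroup.subset[OF G] by (intro has_o_basis_dim_1[OF e]) auto
    next
      case 2
      have "\<chi> \<in> hom ((sym_group (4*n)) \<lparr>carrier := ?S\<rparr>) complex_units"
        using \<chi> SG by (auto simp: hom_def)
      then show ?thesis
        by (rule has_o_basis_subgroup[OF e 2])
    qed
  next
    assume o_basis: "has_o_basis (4*n) e ?S \<chi> (symmetry_class (4*n) e ?S \<chi>)"
    show "dim UNIV = 1 \<or> p = 2 \<or> \<not> p dvd 2 * n"
    proof (rule ccontr)
      assume "\<not> (dim UNIV = 1 \<or> p = 2 \<or> \<not> p dvd 2 * n)"
      then have not1: "dim UNIV \<noteq> 1" and p': "p \<noteq> 2" "p dvd 2 * n"
        by auto
      have "dim UNIV \<noteq> 0"
      proof
        assume "dim UNIV = 0"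
        then have "(UNIV :: 'v set) = {0}"
          using e by (simp add: orthonormal_basis_def)
        then show False
          using \<open>\<exists>v::'v. v \<noteq> 0\<close> by blast
      qed
      with not1 have dim: "dim UNIV \<ge> 2"
        by linarith
      \<comment> \<open>\<open>\<alpha> = (1, 2, \<dots>, 2)\<close>: a permutation that preserves \<open>\<alpha>\<close> fixes the point \<open>1\<close>\<close>
      define \<alpha> where "\<alpha> = (\<lambda>i\<in>{1..4*n}. if i = 1 then 1 else 2 :: nat)"
      have \<alpha>_2: "\<alpha> i = 2" if "i \<in> {1..4*n}" "i \<noteq> 1" for i
        using that by (simp add: \<alpha>_def)
      have \<alpha>_1: "i = 1" if "i \<in> {1..4*n}" "\<alpha> i = 1" for i
        using that \<alpha>_2[of i] by (cases "i = 1") auto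
      have \<alpha>: "\<alpha> \<in> Gamma (4*n)"
        using dim by (auto simp: \<alpha>_def Gamma_def)
      have stab: "g = id" if g: "g \<in> ?G" and "\<alpha> \<circ> g = \<alpha>" for g
      proof -
        have "g 1 \<in> {1..4*n}"
          using n permutes_in_image[OF subgroup_sym_groupD(2)[OF G g], of 1] by auto
        moreover have "\<alpha> (g 1) = 1"
          using fun_cong[OF \<open>\<alpha> \<circ> g = \<alpha>\<close>, of 1] n by (simp add: \<alpha>_def)
        ultimately have "g 1 = 1"
          by (rule \<alpha>_1)
        then show ?thesis
          by (rule dicyclic_fixing_1(1)[OF n g])
      qed
      have "dic_r n \<notin> ?S"
        using p'(2) ord_dic_r[OF n] by (simp add: p_regular_def)
      then have "?S \<subset> ?G"
        using SG dic_r_in_dicyclic by blast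
      note no_o_basis = no_o_basis_if_translates_meet[OF e G \<chi> this \<open>id \<in> ?S\<close> \<alpha>]
      have "\<not> has_o_basis (4*n) e ?S \<chi> (symmetry_class (4*n) e ?S \<chi>)"
      proof (rule no_o_basis)
        show "g = id" if "g \<in> ?G" "\<alpha> \<circ> g = \<alpha>" for g
          using that by (rule stab)
        show "\<exists>\<sigma>\<in>?S. \<sigma> \<circ> k \<in> ?S" if "k \<in> ?G" for k
          using n p p'(1) that by (rule p_regular_dicyclic_translates_meet)
      qed
      with o_basis show False
        by contradiction
    qed
  qed
qed

end
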